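(* Assume $a$ and $b$ are even and $a_0>-b_0$. Let $\rho$ be an admissible initial datum (as defined in the context), let $u_0\in C^1([-1,1])$ satisfy $u_0'(\pm1)=\pm u_0(\pm1)$, and suppose that for some $T>0$ $$\rho(x)<u_0(x)<u(x,T;\rho),\qquad x\in[-1,1].$$ Then for any small $\varepsilon>0$ (with $\varepsilon<\frac12$) there exists $T_\varepsilon>0$ such that $$|u_x(x,t;u_0)|\le M_3,\qquad -1+2\varepsilon<x<1-2\varepsilon,\ t>T_\varepsilon,$$ where $M_3:=\max\{M_2,\ \|u_x(\cdot,T_\varepsilon;u_0)\|_{L^\infty}\}$ and $M_2:=\varepsilon^{-1}\big[\Phi(1-\varepsilon)+\bar c\,T\big]$.
   Context: Let $A$ and $-B$ be smooth positive functions on the unit circle $\mathbb{S}^1$, and for $p\in\mathbb{R}$ put $a(p)=A\big((-p,1)/\sqrt{1+p^2}\big)>0$, $b(p)=B\big((-p,1)/\sqrt{1+p^2}\big)<0$ (smooth bounded functions on $\mathbb{R}$). Notation: $a_0=\min a$, $b_0=\min b$ (infimum over $\mathbb{R}$). Problem (B) with initial datum $u_0$ is: $u_t=a(u_x)\frac{u_{xx}}{1+u_x^2}+b(u_x)\sqrt{1+u_x^2}$ for $-1<x<1$, $t>0$; $u_x(\pm1,t)=\pm u(\pm1,t)$ for $t>0$; $u(x,0)=u_0(x)$ for $-1\le x\le1$. Its (unique, time-global) solution is denoted $u(x,t;u_0)$. For $c\ge0$ let $\varphi(x;c)$ be the maximal solution of $c=a(\varphi')\frac{\varphi''}{1+(\varphi')^2}+b(\varphi')\sqrt{1+(\varphi')^2}$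 with $\varphi(0)=\varphi'(0)=0$; $\varphi(\cdot;0)$ is defined on $[-1,1]$. Let $M\in\mathbb{R}$ be the smallest number with $\varphi'(1;0)\le\varphi(1;0)+M$ and $\varphi'(-1;0)\ge-[\varphi(-1;0)+M]$. Let $\bar c>0$ be the unique number for which the same ODE with $c=\bar c$ has a solution $\Phi$ on $(-1,1)$ with $\Phi'(x)\to\pm\infty$ as $x\to\pm1$; $\Phi$ is normalized by $\Phi(0)=0$ (so $\Phi=\varphi(\cdot;\bar c)$, and $\Phi$ is even). Admissible initial datum: $\rho(x)=\Phi(px)+M_1$, $x\in[-1,1]$, where $p\in[0,1]$ and $M_1$ satisfy $p\,\Phi'(\pm p)=\pm[\Phi(\pm p)+M_1]$ and $M_1>\varphi(x;0)+M$ for all $x\in[-1,1]$. Such $\rho$ is $C^2$, even, and satisfies $\rho'(\pm1)=\pm\rho(\pm1)$ and $\rho>\varphi(\cdot;0)+M$. *)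

theory Defs
  imports "HOL-Analysis.Analysis"
begin

text \<open>Functions on the unit circle are represented by functions on the plane, of which only the
  values on the circle matter; smoothness on the circle is smoothness in the angle.\<close>

definition smooth_on_circle :: "(real \<times> real \<Rightarrow> real) \<Rightarrow> bool" where
  "smooth_on_circle A \<longleftrightarrow>
     (\<forall>n \<theta>. ((deriv ^^ n) (\<lambda>s. A (cos s, sin s))) differentiable (at \<theta>))"

definition positive_on_circle :: "(real \<times> real \<Rightarrow> real) \<Rightarrow> bool" where
  "positive_on_circle A \<longleftrightarrow> (\<forall>z \<in> sphere 0 1. A z > 0)"

definition slope_fun :: "(real \<times> real \<Rightarrow> real) \<Rightarrow> real \<Rightarrow> real" where
  "slope_fun A p = A ((1 / sqrt (1 + p\<^sup>2)) *\<^sub>R (- p, 1))"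

text \<open>The right-hand side of the equation for slope \<open>p = u\<^sub>x\<close> and second derivative
  \<open>q = u\<^sub>x\<^sub>x\<close>.\<close>

definition flow_rhs :: "(real \<Rightarrow> real) \<Rightarrow> (real \<Rightarrow> real) \<Rightarrow> real \<Rightarrow> real \<Rightarrow> real" where
  "flow_rhs a b p q = a p * (q / (1 + p\<^sup>2)) + b p * sqrt (1 + p\<^sup>2)"

text \<open>Classical global solutions of Problem (B): continuous on \<open>[-1,1] \<times> [0,\<infinity>)\<close> and of class
  \<open>C\<^sup>2\<^sup>,\<^sup>1\<close> on \<open>[-1,1] \<times> (0,\<infinity>)\<close>, with one-sided space derivatives at \<open>x = \<plusminus>1\<close>. Values of \<open>u\<close>
  outside \<open>[-1,1] \<times> [0,\<infinity>)\<close> are irrelevant.\<close>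

definition solves_B ::
  "(real \<Rightarrow> real) \<Rightarrow> (real \<Rightarrow> real) \<Rightarrow> (real \<Rightarrow> real) \<Rightarrow> (real \<Rightarrow> real \<Rightarrow> real) \<Rightarrow> bool" where
  "solves_B a b u0 u \<longleftrightarrow>
     continuous_on ({-1..1} \<times> {0..}) (\<lambda>(x, t). u x t) \<and>
     (\<forall>x \<in> {-1..1}. u x 0 = u0 x) \<and>
     (\<exists>ux uxx ut.
        continuous_on ({-1..1} \<times> {0<..}) (\<lambda>(x, t). ux x t) \<and>
        continuous_on ({-1..1} \<times> {0<..}) (\<lambda>(x, t). uxx x t) \<and>
        continuous_on ({-1..1} \<times> {0<..}) (\<lambda>(x, t). ut x t) \<and>
        (\<forall>x \<in> {-1..1}. \<forall>t > 0.
           ((\<lambda>y. u y t) has_real_derivative ux x t) (at x within {-1..1}) \<and>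
           ((\<lambda>y. ux y t) has_real_derivative uxx x t) (at x within {-1..1}) \<and>
           ((\<lambda>s. u x s) has_real_derivative ut x t) (at t)) \<and>
        (\<forall>x \<in> {-1<..<1}. \<forall>t > 0. ut x t = flow_rhs a b (ux x t) (uxx x t)) \<and>
        (\<forall>t > 0. ux 1 t = u 1 t \<and> ux (-1) t = - u (-1) t))"

definition Dx :: "(real \<Rightarrow> real \<Rightarrow> real) \<Rightarrow> real \<Rightarrow> real \<Rightarrow> real" where
  "Dx u x t = vector_derivative (\<lambda>y. u y t) (at x within {-1..1})"

definition profile_ode ::
  "(real \<Rightarrow> real) \<Rightarrow> (real \<Rightarrow> real) \<Rightarrow> real \<Rightarrow> (real \<Rightarrow> real) \<Rightarrow> real set \<Rightarrow> bool" where
  "profile_ode a b c f S \<longleftrightarrow>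
     (\<forall>x \<in> S. f differentiable (at x) \<and> deriv f differentiable (at x) \<and>
        c = flow_rhs a b (deriv f x) (deriv (deriv f) x))"

definition maximal_profile ::
  "(real \<Rightarrow> real) \<Rightarrow> (real \<Rightarrow> real) \<Rightarrow> real \<Rightarrow> (real \<Rightarrow> real) \<Rightarrow> real set \<Rightarrow> bool" where
  "maximal_profile a b c \<phi> I \<longleftrightarrow>
     open I \<and> is_interval I \<and> 0 \<in> I \<and> profile_ode a b c \<phi> I \<and> \<phi> 0 = 0 \<and> deriv \<phi> 0 = 0 \<and>
     (\<forall>\<psi> J. open J \<and> is_interval J \<and> I \<subseteq> J \<and> profile_ode a b c \<psi> J \<and> (\<forall>x \<in> I. \<psi> x = \<phi> x)
        \<longrightarrow> J = I)"

definition shift_const :: "(real \<Rightarrow> real) \<Rightarrow> real" where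
  "shift_const \<phi> =
     (LEAST m. deriv \<phi> 1 \<le> \<phi> 1 + m \<and> deriv \<phi> (-1) \<ge> - (\<phi> (-1) + m))"

definition travelling_profile ::
  "(real \<Rightarrow> real) \<Rightarrow> (real \<Rightarrow> real) \<Rightarrow> real \<Rightarrow> (real \<Rightarrow> real) \<Rightarrow> bool" where
  "travelling_profile a b c \<Phi> \<longleftrightarrow>
     profile_ode a b c \<Phi> {-1<..<1} \<and> \<Phi> 0 = 0 \<and>
     filterlim (deriv \<Phi>) at_top (at_left 1) \<and>
     filterlim (deriv \<Phi>) at_bot (at_right (-1))"

text \<open>The value \<open>p = 1\<close> is excluded explicitly: \<open>\<Phi>'\<close> is infinite at \<open>\<plusminus>1\<close>, so the condition
  \<open>p \<Phi>'(\<plusminus>p) = \<plusminus>(\<Phi>(\<plusminus>p) + M\<^sub>1)\<close> cannot hold there, whereas \<open>deriv \<Phi> 1\<close> is an arbitrary real.\<close>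

definition admissible_datum ::
  "(real \<Rightarrow> real) \<Rightarrow> (real \<Rightarrow> real) \<Rightarrow> (real \<Rightarrow> real) \<Rightarrow> bool" where
  "admissible_datum \<phi> \<Phi> \<rho> \<longleftrightarrow>
     (\<exists>p M1. 0 \<le> p \<and> p < 1 \<and>
        p * deriv \<Phi> p = \<Phi> p + M1 \<and> p * deriv \<Phi> (- p) = - (\<Phi> (- p) + M1) \<and>
        (\<forall>x \<in> {-1..1}. M1 > \<phi> x + shift_const \<phi>) \<and>
        (\<forall>x \<in> {-1..1}. \<rho> x = \<Phi> (p * x) + M1))"

end

theory Submission
  imports Defs
begin

text \<open>Why the theorem holds.  Only first and second derivatives of \<open>u\<close> are at hand, so the slope
  \<open>u\<^sub>x\<close> is never differentiated twice.  Instead, all estimates come from a single maximum principle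
  (\<open>touching_principle\<close>), applied mostly to doubled quantities such as \<open>u(y,t) - u(x,t) - \<Psi>(y - x)\<close>:
  where such a quantity has an interior maximum, the two slopes are prescribed, so the forcing terms
  nearly cancel and the concavity of the test function decides the sign of the time derivative.

  The oscillation of \<open>u\<close> is controlled through the solution \<open>v\<close> that starts from \<open>\<rho>\<close>: by
  comparison, \<open>v(x,t) < u(x,t) < v(x,t+T)\<close>.  If \<open>v\<close> were known to be even, the slope comparison \<open>v\<^sub>x \<le> \<Phi>'\<close> on \<open>x \<ge> 0\<close> would bound both the shape of \<open>v\<close> and its
  speed at the origin.  Evenness would need uniqueness for a problem whose boundary condition has the
  bad sign; a weaker symmetry suffices.  As \<open>\<rho>\<close> is even and lies strictly below \<open>v\<close> at time \<open>T\<close>, both \<open>v(x,t)\<close> and its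
  reflection \<open>v(-x,t)\<close> stay below \<open>v(x,t+T)\<close>.  This controls the edges \<open>\<bar>x\<bar> = \<bar>y\<bar>\<close> when one compares
  \<open>v(y,t)\<close> with \<open>v(x,t+T)\<close> on \<open>\<bar>x\<bar> \<le> \<bar>y\<bar>\<close>, and gives
  \<open>v(y,t) - v(x,t+T) \<le> \<Phi>(y) - \<Phi>(x)\<close> (\<open>increment_below_profile\<close>) and \<open>v(x,t) \<le> v(y,t+T)\<close>
  (\<open>ordered_across_moduli\<close>).  The travelling wave \<open>\<Phi> + ct\<close> is an upper barrier because its slope is
  infinite at the ends (\<open>below_travelling_wave\<close>).  Chaining the three yields
  \<open>u(y,t) - u(x,t) \<le> \<Phi>(y) + 3cT\<close> for \<open>t \<ge> 2T\<close> (\<open>oscillation_bound\<close>).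

  A solution of bounded oscillation on \<open>[-r,r]\<close> for all large times has slopes
  bounded on a smaller interval, uniformly in time (\<open>interior_slope_estimate\<close>): compare
  \<open>u(y,t) - u(x,t)\<close> with a concave modulus that rises above the oscillation within a short distance,
  plus quadratic penalties that do the same near the ends.  Let \<open>K\<close> be the resulting bound.

  It remains to choose \<open>T\<^sub>\<epsilon>\<close>.  The quantity \<open>M\<^sub>3\<close> contains the maximal slope on all of \<open>[-1,1]\<close> at time
  \<open>T\<^sub>\<epsilon>\<close>.  These maximal slopes are unbounded in time (\<open>unbounded_slopes\<close>): otherwise \<open>u\<close>, which equals
  its slope at \<open>x = 1\<close>, would stay bounded there, while the linearised equation for the distance of
  \<open>u\<close> to the stationary profile below it, with boundary condition of the bad sign, forces linear
  growth.  So some \<open>T\<^sub>\<epsilon> \<ge> 2T\<close> has a maximal slope above \<open>K\<close>, and \<open>K\<close> bounds all later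
  interior slopes.\<close>

section \<open>The touching principle\<close>

text \<open>If \<open>Z\<close> became positive, \<open>Z\<close> minus a small increasing linear function of time would have a first
  zero; there \<open>Z\<close> is at a spatial maximum, small and positive, and has positive time derivative.
  The bound \<open>\<eta>\<close> lets users of the lemma assume that \<open>Z\<close> is only barely positive, which is how strict
  inequalities are exploited at boundary points.\<close>

lemma touching_principle:
  fixes Z :: "'a::metric_space \<Rightarrow> real \<Rightarrow> real"
  assumes X: "compact X" and cont: "continuous_on (X \<times> {ta..tb}) (\<lambda>(x,t). Z x t)"
    and eta: "\<eta> > 0" and init: "\<And>x. x \<in> X \<Longrightarrow> Z x ta \<le> 0"
    and decr: "\<And>x t. \<lbrakk>x \<in> X; ta < t; t \<le> tb; 0 < Z x t; Z x t < \<eta>; \<And>x'. x' \<in> X \<Longrightarrow> Z x' t \<le> Z x t\<rbrakk>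
      \<Longrightarrow> \<exists>D\<le>0. (Z x has_real_derivative D) (at t)"
    and x: "x \<in> X" and t: "ta \<le> t" "t \<le> tb"
  shows "Z x t \<le> 0"
proof (rule ccontr)
  assume "\<not> Z x t \<le> 0"
  then have pos: "Z x t > 0" by simp
  define m where "m = min (Z x t) \<eta>"
  have m: "m > 0" "m \<le> Z x t" "m \<le> \<eta>" using pos eta by (auto simp: m_def)
  \<comment> \<open>The slope of the tilt; it keeps the tilted function positive at the point where \<open>Z\<close> is.\<close>
  define \<theta> where "\<theta> = m / (2 * (tb - ta + 1))"
  have len: "tb - ta + 1 > 0" using t by linarith
  have th: "\<theta> > 0" using m len by (simp add: \<theta>_def)
  have small: "\<theta> * (s - ta + 1) \<le> m / 2" if "s \<le> tb" for s
  proof -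
    have "\<theta> * (s - ta + 1) \<le> \<theta> * (tb - ta + 1)" using th that by (intro mult_left_mono) auto
    also have "\<dots> = m / 2" using len by (simp add: \<theta>_def field_simps)
    finally show ?thesis .
  qed
  define W where "W y s = Z y s - \<theta> * (s - ta + 1)" for y s
  have contW: "continuous_on (X \<times> {ta..tb}) (\<lambda>p. W (fst p) (snd p))"
    unfolding W_def using cont by (auto intro!: continuous_intros simp: case_prod_beta)
  define P where "P = {p \<in> X \<times> {ta..tb}. 0 \<le> W (fst p) (snd p)}"
  have cX: "compact (X \<times> {ta..tb})" using X by (intro compact_Times) auto
  have Peq: "P = (X \<times> {ta..tb}) \<inter> (\<lambda>p. W (fst p) (snd p)) -` {0..}" by (auto simp: P_def)
  have "closed P" unfolding Peq
    by (rule continuous_closed_preimage[OF contW compact_imp_closed[OF cX] closed_atLeast])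
  then have "compact ((X \<times> {ta..tb}) \<inter> P)" by (rule compact_Int_closed[OF cX])
  moreover have "(X \<times> {ta..tb}) \<inter> P = P" by (auto simp: P_def)
  ultimately have cP: "compact P" by simp
  have "W x t \<ge> 0" using small[OF t(2)] m by (simp add: W_def)
  then have "(x,t) \<in> P" using x t by (simp add: P_def)
  then obtain q where q: "q \<in> P" and qmin: "\<And>p. p \<in> P \<Longrightarrow> snd q \<le> snd p"
    using continuous_attains_inf[OF cP _ continuous_on_snd[OF continuous_on_id]] by blast
  obtain y s where ys: "q = (y,s)" by (cases q)
  have y: "y \<in> X" and s: "ta \<le> s" "s \<le> tb" and Wys: "W y s \<ge> 0" using q by (auto simp: P_def ys)
  \<comment> \<open>Minimality of \<open>s\<close>; the intermediate value theorem turns it into an upper bound at time \<open>s\<close>.\<close>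
  have before: "W y' s' < 0" if "y' \<in> X" "ta \<le> s'" "s' < s" for y' s'
    using qmin[of "(y',s')"] that s by (force simp: P_def ys)
  have initW: "W y' ta < 0" if "y' \<in> X" for y'
    using init[OF that] th by (simp add: W_def)
  have s1: "ta < s" using initW[OF y] Wys s by (cases "s = ta") auto
  have maxW: "W y' s \<le> 0" if y': "y' \<in> X" for y'
  proof (rule ccontr)
    assume "\<not> W y' s \<le> 0"
    then have gt: "W y' s > 0" by simp
    have "continuous_on {ta..s} (\<lambda>r. W (fst (y',r)) (snd (y',r)))"
      by (rule continuous_on_compose2[OF contW]) (use y' s in \<open>auto intro!: continuous_intros\<close>)
    then have "continuous_on {ta..s} (W y')" by simp
    then obtain r where "ta \<le> r" "r \<le> s" "W y' r = 0"
      using IVT'[of "W y'" ta 0 s] initW[OF y'] gt s1 by auto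
    with before[OF y', of r] gt show False by (cases "r = s") auto
  qed
  have Ws: "W y s = 0" using maxW[OF y] Wys by simp
  have Zs: "Z y s = \<theta> * (s - ta + 1)" using Ws by (simp add: W_def)
  have "0 < Z y s" using Zs th s1 by simp
  moreover have "Z y s < \<eta>" using Zs small[OF s(2)] m by linarith
  moreover have "Z y' s \<le> Z y s" if "y' \<in> X" for y' using maxW[OF that] Ws by (simp add: W_def)
  ultimately obtain D where D: "D \<le> 0" "(Z y has_real_derivative D) (at s)"
    using decr[OF y s1 s(2)] by blast
  have "(W y has_real_derivative D - \<theta>) (at s)"
    unfolding W_def by (auto intro!: derivative_eq_intros D(2))
  from DERIV_neg_dec_left[OF this] D(1) th obtain d where d: "d > 0"
    "\<And>h. 0 < h \<Longrightarrow> h < d \<Longrightarrow> W y s < W y (s - h)" by auto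
  define h where "h = min (d/2) (s - ta)"
  have h: "0 < h" "h < d" "ta \<le> s - h" using d(1) s1 by (auto simp: h_def min_def)
  have "W y (s - h) < 0" using before[OF y h(3)] h by simp
  with d(2)[OF h(1,2)] Ws show False by simp
qed

lemma interior_max_derivs:
  fixes f f' :: "real \<Rightarrow> real"
  assumes e: "e > 0" and f: "\<And>y. \<bar>y - x\<bar> < e \<Longrightarrow> (f has_real_derivative f' y) (at y)"
    and f2: "(f' has_real_derivative D) (at x)" and mx: "\<And>y. \<bar>y - x\<bar> < e \<Longrightarrow> f y \<le> f x"
  shows "f' x = 0 \<and> D \<le> 0"
proof -
  have z: "f' x = 0"
    by (rule DERIV_local_max[OF f e]) (use e mx in \<open>auto simp: abs_minus_commute\<close>)
  have "D \<le> 0"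
  proof (rule ccontr)
    assume "\<not> D \<le> 0"
    then obtain d where d: "d > 0" "\<And>h. 0 < h \<Longrightarrow> h < d \<Longrightarrow> f' x < f' (x + h)"
      using DERIV_pos_inc_right[OF f2] by auto
    define h where "h = min d e / 2"
    have h: "0 < h" "h < d" "h < e" using d e by (auto simp: h_def min_def)
    obtain w where w: "x < w" "w < x + h" "f (x + h) - f x = (x + h - x) * f' w"
      using MVT2[of x "x + h" f f'] h f by auto
    have "f' w > 0" using d(2)[of "w - x"] w h z by auto
    then have "f (x + h) > f x" using w h mult_pos_pos[of h "f' w"] by (smt (verit) w(3))
    with mx[of "x + h"] h show False by auto
  qed
  with z show ?thesis by simp
qed

lemma left_max_deriv_nonneg:
  fixes f :: "real \<Rightarrow> real"
  assumes "(f has_real_derivative l) (at x within S)" "e > 0"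
    and "\<And>y. x - e < y \<Longrightarrow> y < x \<Longrightarrow> y \<in> S \<and> f y \<le> f x"
  shows "l \<ge> 0"
proof (rule ccontr)
  assume "\<not> l \<ge> 0"
  then obtain d where d: "d > 0" "\<And>h. 0 < h \<Longrightarrow> x - h \<in> S \<Longrightarrow> h < d \<Longrightarrow> f x < f (x - h)"
    using has_real_derivative_neg_dec_left[OF assms(1)] by auto
  define h where "h = min d e / 2"
  have h: "0 < h" "h < d" "h < e" using d assms(2) by (auto simp: h_def min_def)
  show False using assms(3)[of "x - h"] d(2)[of h] h by fastforce
qed

lemma right_max_deriv_nonpos:
  fixes f :: "real \<Rightarrow> real"
  assumes "(f has_real_derivative l) (at x within S)" "e > 0"
    and "\<And>y. x < y \<Longrightarrow> y < x + e \<Longrightarrow> y \<in> S \<and> f y \<le> f x"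
  shows "l \<le> 0"
proof (rule ccontr)
  assume "\<not> l \<le> 0"
  then obtain d where d: "d > 0" "\<And>h. 0 < h \<Longrightarrow> x + h \<in> S \<Longrightarrow> h < d \<Longrightarrow> f x < f (x + h)"
    using has_real_derivative_pos_inc_right[OF assms(1)] by auto
  define h where "h = min d e / 2"
  have h: "0 < h" "h < d" "h < e" using d assms(2) by (auto simp: h_def min_def)
  show False using assms(3)[of "x + h"] d(2)[of h] h by fastforce
qed

lemma max_at_right_end:
  fixes f :: "real \<Rightarrow> real"
  assumes "(f has_real_derivative l) (at c within {d..c})" "d < c" "\<And>y. y \<in> {d..c} \<Longrightarrow> f y \<le> f c"
  shows "l \<ge> 0"
  by (rule left_max_deriv_nonneg[OF assms(1), of "c - d"]) (use assms(2,3) in auto)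

lemma max_at_left_end:
  fixes f :: "real \<Rightarrow> real"
  assumes "(f has_real_derivative l) (at c within {c..d})" "c < d" "\<And>y. y \<in> {c..d} \<Longrightarrow> f y \<le> f c"
  shows "l \<le> 0"
  by (rule right_max_deriv_nonpos[OF assms(1), of "d - c"]) (use assms(2,3) in auto)

section \<open>Classical solutions touched by test functions\<close>

text \<open>The derivatives are exposed as parameters, so that statements can speak of the slope and the time
  derivative of a solution.\<close>

definition classical_solution where
  "classical_solution a b u ux uxx ut \<longleftrightarrow>
     continuous_on ({-1..1} \<times> {0..}) (\<lambda>(x, t). u x t) \<and>
     continuous_on ({-1..1} \<times> {0<..}) (\<lambda>(x, t). ux x t) \<and>
     (\<forall>x \<in> {-1..1}. \<forall>t > 0.
        ((\<lambda>y. u y t) has_real_derivative ux x t) (at x within {-1..1}) \<and>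
        ((\<lambda>y. ux y t) has_real_derivative uxx x t) (at x within {-1..1}) \<and>
        (u x has_real_derivative ut x t) (at t)) \<and>
     (\<forall>x \<in> {-1<..<1}. \<forall>t > 0. ut x t = flow_rhs a b (ux x t) (uxx x t)) \<and>
     (\<forall>t > 0. ux 1 t = u 1 t \<and> ux (-1) t = - u (-1) t)"

lemma solves_B_imp_classical_solution:
  assumes "solves_B a b u0 u"
  obtains ux uxx ut where "classical_solution a b u ux uxx ut"
  using assms unfolding solves_B_def classical_solution_def by blast

lemma classical_solutionD:
  assumes "classical_solution a b u ux uxx ut" "t > 0"
  shows "-1 \<le> x \<Longrightarrow> x \<le> 1 \<Longrightarrow> ((\<lambda>y. u y t) has_real_derivative ux x t) (at x within {-1..1})"
    and "-1 \<le> x \<Longrightarrow> x \<le> 1 \<Longrightarrow> (u x has_real_derivative ut x t) (at t)"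
    and "\<bar>x\<bar> < 1 \<Longrightarrow> ((\<lambda>y. u y t) has_real_derivative ux x t) (at x)"
    and "\<bar>x\<bar> < 1 \<Longrightarrow> ((\<lambda>y. ux y t) has_real_derivative uxx x t) (at x)"
    and "\<bar>x\<bar> < 1 \<Longrightarrow> ut x t = flow_rhs a b (ux x t) (uxx x t)"
    and "ux 1 t = u 1 t" and "ux (-1) t = - u (-1) t"
proof -
  show "-1 \<le> x \<Longrightarrow> x \<le> 1 \<Longrightarrow> ((\<lambda>y. u y t) has_real_derivative ux x t) (at x within {-1..1})"
    "-1 \<le> x \<Longrightarrow> x \<le> 1 \<Longrightarrow> (u x has_real_derivative ut x t) (at t)"
    "ux 1 t = u 1 t" "ux (-1) t = - u (-1) t"
    using assms by (simp_all add: classical_solution_def)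
  assume x: "\<bar>x\<bar> < 1"
  then have "at x within {-1..1} = at x" by (intro at_within_Icc_at) auto
  then show "((\<lambda>y. u y t) has_real_derivative ux x t) (at x)"
    "((\<lambda>y. ux y t) has_real_derivative uxx x t) (at x)"
    using assms x unfolding classical_solution_def
    by (metis abs_le_iff atLeastAtMost_iff less_eq_real_def minus_le_iff)+
  show "ut x t = flow_rhs a b (ux x t) (uxx x t)"
    using assms x by (simp add: classical_solution_def abs_less_iff)
qed

lemma continuous_on_solution:
  assumes "classical_solution a b u ux uxx ut"
    and "continuous_on W f" "continuous_on W g"
    and "\<And>w. w \<in> W \<Longrightarrow> -1 \<le> f w \<and> f w \<le> 1 \<and> 0 \<le> g w"
  shows "continuous_on W (\<lambda>w. u (f w) (g w))"
proof -
  have "continuous_on ({-1..1} \<times> {0..}) (\<lambda>p. u (fst p) (snd p))"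
    using assms(1) by (simp add: classical_solution_def case_prod_beta)
  from continuous_on_compose2[OF this continuous_on_Pair[OF assms(2,3)]] show ?thesis
    using assms(4) by (auto simp: image_subset_iff)
qed

lemma time_shift_solution:
  assumes S: "classical_solution a b u ux uxx ut" and T: "T \<ge> 0"
  shows "classical_solution a b (\<lambda>x t. u x (t + T)) (\<lambda>x t. ux x (t + T))
    (\<lambda>x t. uxx x (t + T)) (\<lambda>x t. ut x (t + T))"
proof -
  have 1: "continuous_on ({-1..1} \<times> {0..}) (\<lambda>p. u (fst p) (snd p + T))"
    by (rule continuous_on_solution[OF S]) (use T in \<open>auto intro!: continuous_intros\<close>)
  have "continuous_on ({-1..1} \<times> {0<..}) (\<lambda>p. ux (fst p) (snd p))"
    using S by (simp add: classical_solution_def case_prod_beta)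
  from continuous_on_compose2[OF this, of "{-1..1} \<times> {0<..}" "\<lambda>p. (fst p, snd p + T)"]
  have 2: "continuous_on ({-1..1} \<times> {0<..}) (\<lambda>p. ux (fst p) (snd p + T))"
    using T by (force intro!: continuous_intros)
  have 3: "((\<lambda>s. u x (s + T)) has_real_derivative ut x (t + T)) (at t)"
    if "x \<in> {-1..1}" "t > 0" for x t
  proof -
    have "(u x has_real_derivative ut x (t + T)) (at (t + T))"
      using S that T by (simp add: classical_solution_def)
    then show ?thesis by (simp add: DERIV_shift)
  qed
  show ?thesis using S T 1 2 3 unfolding classical_solution_def case_prod_beta
    by (auto simp: add_pos_nonneg)
qed

locale flow =
  fixes a b :: "real \<Rightarrow> real"
  assumes a_pos: "a p > 0"
begin

abbreviation "sol \<equiv> classical_solution a b"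

lemma flow_rhs_mono: "q \<le> q' \<Longrightarrow> flow_rhs a b p q \<le> flow_rhs a b p q'"
  unfolding flow_rhs_def using a_pos[of p]
  by (auto intro!: mult_left_mono divide_right_mono simp: add_nonneg_nonneg)

text \<open>Classical solutions are subsolutions in the viscosity sense: the second derivative at a touching
  point is bounded by that of the test function, and the right-hand side is increasing in it.\<close>

lemma touch_above:
  assumes S: "sol u ux uxx ut" and x: "\<bar>x\<bar> < 1" and t: "t > 0" and e: "e > 0"
    and g: "\<And>y. \<bar>y - x\<bar> < e \<Longrightarrow> (g has_real_derivative g' y) (at y)"
    and g2: "(g' has_real_derivative g2) (at x)"
    and mx: "\<And>y. \<bar>y - x\<bar> < e \<Longrightarrow> u y t - g y \<le> u x t - g x"
  shows "ux x t = g' x" and "ut x t \<le> flow_rhs a b (g' x) g2"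
proof -
  define d where "d = min e (1 - \<bar>x\<bar>)"
  have d: "d > 0" "\<And>y. \<bar>y - x\<bar> < d \<Longrightarrow> \<bar>y - x\<bar> < e \<and> \<bar>y\<bar> < 1"
    using e x by (auto simp: d_def)
  have "ux x t - g' x = 0 \<and> uxx x t - g2 \<le> 0"
    by (rule interior_max_derivs[of d _ "\<lambda>y. u y t - g y"])
      (use d mx in \<open>auto intro!: derivative_eq_intros g g2 classical_solutionD[OF S t] x\<close>)
  then have 1: "ux x t = g' x" "uxx x t \<le> g2" by auto
  then show "ux x t = g' x" by simp
  from 1 show "ut x t \<le> flow_rhs a b (g' x) g2"
    using classical_solutionD(5)[OF S t x] flow_rhs_mono by simp
qed

lemma touch_below:
  assumes S: "sol u ux uxx ut" and x: "\<bar>x\<bar> < 1" and t: "t > 0" and e: "e > 0"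
    and g: "\<And>y. \<bar>y - x\<bar> < e \<Longrightarrow> (g has_real_derivative g' y) (at y)"
    and g2: "(g' has_real_derivative g2) (at x)"
    and mx: "\<And>y. \<bar>y - x\<bar> < e \<Longrightarrow> u y t - g y \<ge> u x t - g x"
  shows "ux x t = g' x" and "ut x t \<ge> flow_rhs a b (g' x) g2"
proof -
  define d where "d = min e (1 - \<bar>x\<bar>)"
  have d: "d > 0" "\<And>y. \<bar>y - x\<bar> < d \<Longrightarrow> \<bar>y - x\<bar> < e \<and> \<bar>y\<bar> < 1"
    using e x by (auto simp: d_def)
  have mx': "g y - u y t \<le> g x - u x t" if "\<bar>y - x\<bar> < e" for y using mx[OF that] by simp
  have "g' x - ux x t = 0 \<and> g2 - uxx x t \<le> 0"
    by (rule interior_max_derivs[of d _ "\<lambda>y. g y - u y t"])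
      (use d mx' in \<open>auto intro!: derivative_eq_intros g g2 classical_solutionD[OF S t] x\<close>)
  then have 1: "ux x t = g' x" "uxx x t \<ge> g2" by auto
  then show "ux x t = g' x" by simp
  from 1 show "ut x t \<ge> flow_rhs a b (g' x) g2"
    using classical_solutionD(5)[OF S t x] flow_rhs_mono by simp
qed

section \<open>Comparison of solutions\<close>

text \<open>The minimal gap \<open>\<delta>\<close> between a solution and a subsolution never shrinks.  At an interior minimum of
  the gap the slopes agree, so the lower-order terms cancel.  At \<open>x = \<plusminus>1\<close> the boundary condition
  with the bad sign helps: a positive gap has a positive outward derivative, so it is not minimal
  there.  This is why strict inequality of the data is required, and why a quantitative gap comes out.\<close>

lemma strict_comparison:
  assumes S: "sol u ux uxx ut"
    and contV: "continuous_on ({-1..1} \<times> {0..}) (\<lambda>(x, t). V x t)"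
    and Vx: "\<And>x t. x \<in> {-1..1} \<Longrightarrow> t > 0 \<Longrightarrow>
      ((\<lambda>y. V y t) has_real_derivative Vx x t) (at x within {-1..1})"
    and Vxx: "\<And>x t. \<bar>x\<bar> < 1 \<Longrightarrow> t > 0 \<Longrightarrow> ((\<lambda>y. Vx y t) has_real_derivative Vxx x t) (at x)"
    and Vt: "\<And>x t. x \<in> {-1..1} \<Longrightarrow> t > 0 \<Longrightarrow> (V x has_real_derivative Vt x t) (at t)"
    and sub: "\<And>x t. \<bar>x\<bar> < 1 \<Longrightarrow> t > 0 \<Longrightarrow> Vt x t \<le> flow_rhs a b (Vx x t) (Vxx x t)"
    and bc: "\<And>t. t > 0 \<Longrightarrow> Vx 1 t \<le> V 1 t" "\<And>t. t > 0 \<Longrightarrow> Vx (-1) t \<ge> - V (-1) t"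
    and init: "\<And>x. x \<in> {-1..1} \<Longrightarrow> V x 0 < u x 0"
  obtains \<delta> where "\<delta> > 0" "\<And>x t. x \<in> {-1..1} \<Longrightarrow> t \<ge> 0 \<Longrightarrow> V x t + \<delta> \<le> u x t"
proof -
  have contV': "continuous_on W (\<lambda>w. V (f w) (g w))"
    if "continuous_on W f" "continuous_on W g"
      "\<And>w. w \<in> W \<Longrightarrow> -1 \<le> f w \<and> f w \<le> 1 \<and> 0 \<le> g w" for W :: "'c::topological_space set" and f g
    using continuous_on_compose2[OF contV[unfolded case_prod_beta] continuous_on_Pair[OF that(1,2)]]
      that(3) by (auto simp: image_subset_iff)
  have "continuous_on {-1..1} (\<lambda>x. u x 0 - V x 0)"
    by (intro continuous_intros continuous_on_solution[OF S]) (use contV'[of "{-1..1}" "\<lambda>x. x" "\<lambda>x. 0"] in auto)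
  from continuous_attains_inf[OF compact_Icc _ this] obtain x0 where
    x0: "x0 \<in> {-1..1}" "\<And>x. x \<in> {-1..1} \<Longrightarrow> u x0 0 - V x0 0 \<le> u x 0 - V x 0"
    by auto
  define \<delta> where "\<delta> = u x0 0 - V x0 0"
  have \<delta>: "\<delta> > 0" using init[OF x0(1)] by (simp add: \<delta>_def)
  have "V x \<tau> + \<delta> \<le> u x \<tau>" if x: "x \<in> {-1..1}" and \<tau>: "\<tau> \<ge> 0" for x \<tau>
  proof -
    have "\<delta> - (u x \<tau> - V x \<tau>) \<le> 0"
    proof (rule touching_principle[where Z = "\<lambda>x t. \<delta> - (u x t - V x t)" and \<eta> = \<delta> and tb = \<tau>,
          OF compact_Icc _ \<delta> _ _ x \<tau> order_refl])
      show "continuous_on ({-1..1} \<times> {0..\<tau>}) (\<lambda>(x, t). \<delta> - (u x t - V x t))"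
        unfolding case_prod_beta
        by (intro continuous_intros continuous_on_solution[OF S] contV') auto
      show "\<delta> - (u x 0 - V x 0) \<le> 0" if "x \<in> {-1..1}" for x
        using x0(2)[OF that] by (simp add: \<delta>_def)
      fix x t assume x: "x \<in> {-1..1}" and t: "0 < t" and Z: "0 < \<delta> - (u x t - V x t)"
        "\<delta> - (u x t - V x t) < \<delta>"
        and mx: "\<And>x'. x' \<in> {-1..1} \<Longrightarrow> \<delta> - (u x' t - V x' t) \<le> \<delta> - (u x t - V x t)"
      have mx': "u x t - V x t \<le> u y t - V y t" if "y \<in> {-1..1}" for y using mx[OF that] by simp
      have mx'': "V y t - u y t \<le> V x t - u x t" if "y \<in> {-1..1}" for y using mx[OF that] by simp
      have dx: "((\<lambda>y. V y t - u y t) has_real_derivative Vx x t - ux x t) (at x within {-1..1})"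
        using x t by (intro derivative_intros Vx classical_solutionD[OF S t]) auto
      \<comment> \<open>At an end the gap lies strictly between \<open>0\<close> and \<open>\<delta>\<close>, hence increases outwards.\<close>
      have "x \<noteq> 1"
      proof
        assume "x = 1"
        then have "Vx 1 t - ux 1 t \<ge> 0"
          using dx mx'' by (intro max_at_right_end[of "\<lambda>y. V y t - u y t" _ 1 "-1"]) auto
        with bc(1)[OF t] classical_solutionD(6)[OF S t] Z \<open>x = 1\<close> show False by simp
      qed
      moreover have "x \<noteq> -1"
      proof
        assume "x = -1"
        then have "Vx (-1) t - ux (-1) t \<le> 0"
          using dx mx'' by (intro max_at_left_end[of "\<lambda>y. V y t - u y t" _ "-1" 1]) auto
        with bc(2)[OF t] classical_solutionD(7)[OF S t] Z \<open>x = -1\<close> show False by simp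
      qed
      ultimately have x1: "\<bar>x\<bar> < 1" using x by auto
      have near: "-1 < y \<and> y < 1" if "\<bar>y - x\<bar> < 1 - \<bar>x\<bar>" for y using that by linarith
      have "ut x t \<ge> flow_rhs a b (Vx x t) (Vxx x t)"
      proof (rule touch_below(2)[OF S x1 t])
        show "1 - \<bar>x\<bar> > 0" using x1 by simp
        show "((\<lambda>y. V y t) has_real_derivative Vx y t) (at y)" if "\<bar>y - x\<bar> < 1 - \<bar>x\<bar>" for y
          using Vx[of y t] near[OF that] t at_within_Icc_at[of "-1" y 1] by auto
        show "u x t - V x t \<le> u y t - V y t" if "\<bar>y - x\<bar> < 1 - \<bar>x\<bar>" for y
          using mx'[of y] near[OF that] by auto
      qed (use Vxx x1 t in auto)
      with sub[OF x1 t] have "0 - (ut x t - Vt x t) \<le> 0" by simp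
      moreover have "((\<lambda>t. \<delta> - (u x t - V x t)) has_real_derivative 0 - (ut x t - Vt x t)) (at t)"
        using x t by (intro derivative_intros Vt classical_solutionD(2)[OF S t]) auto
      ultimately show "\<exists>D\<le>0. ((\<lambda>t. \<delta> - (u x t - V x t)) has_real_derivative D) (at t)" by blast
    qed
    then show ?thesis by simp
  qed
  with \<delta> that show thesis by blast
qed

lemma solutions_ordered:
  assumes U: "sol u ux uxx ut" and V: "sol v vx vxx vt"
    and init: "\<And>x. x \<in> {-1..1} \<Longrightarrow> v x 0 < u x 0"
    and x: "x \<in> {-1..1}" and t: "t \<ge> 0"
  shows "v x t < u x t"
proof -
  obtain \<delta> where "\<delta> > 0" "\<And>x t. x \<in> {-1..1} \<Longrightarrow> t \<ge> 0 \<Longrightarrow> v x t + \<delta> \<le> u x t"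
  proof (rule strict_comparison[OF U])
    show "continuous_on ({-1..1} \<times> {0..}) (\<lambda>(x, t). v x t)"
      using V by (simp add: classical_solution_def)
  qed (use init in \<open>auto intro!: classical_solutionD[OF V]
        simp: classical_solutionD(5,6,7)[OF V]\<close>)
  with x t show ?thesis by fastforce
qed

text \<open>The case of a subsolution at rest.  It keeps the boundary values of solutions positive, and its gap
  is what later grows in time.\<close>

lemma stationary_gap:
  assumes W: "sol w wx wxx wt"
    and \<psi>: "\<And>x. x \<in> {-1..1} \<Longrightarrow> (\<psi> has_real_derivative \<psi>' x) (at x)"
    and \<psi>2: "\<And>x. x \<in> {-1..1} \<Longrightarrow> (\<psi>' has_real_derivative \<psi>'' x) (at x)"
    and stat: "\<And>x. x \<in> {-1..1} \<Longrightarrow> flow_rhs a b (\<psi>' x) (\<psi>'' x) = 0"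
    and bc: "\<psi>' 1 \<le> \<psi> 1" "\<psi>' (-1) \<ge> - \<psi> (-1)"
    and init: "\<And>x. x \<in> {-1..1} \<Longrightarrow> \<psi> x < w x 0"
  obtains \<delta> where "\<delta> > 0" "\<And>x t. x \<in> {-1..1} \<Longrightarrow> t \<ge> 0 \<Longrightarrow> \<psi> x + \<delta> \<le> w x t"
proof -
  have "continuous_on {-1..1} \<psi>"
    by (rule DERIV_continuous_on[where D = \<psi>'], rule has_field_derivative_at_within, rule \<psi>)
  then have "continuous_on ({-1..1} \<times> {0..}) (\<lambda>q :: real \<times> real. \<psi> (fst q))"
    by (rule continuous_on_compose2) (auto intro!: continuous_intros)
  then have cont: "continuous_on ({-1..1} \<times> {0..}) (\<lambda>(x, t :: real). \<psi> x)"
    unfolding case_prod_beta .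
  show thesis
  proof (rule strict_comparison[OF W cont, where Vx = "\<lambda>x t. \<psi>' x" and Vxx = "\<lambda>x t. \<psi>'' x" and Vt = "\<lambda>x t. 0"])
    show "(\<psi> has_real_derivative \<psi>' x) (at x within {-1..1})" if "x \<in> {-1..1}" for x
      by (rule has_field_derivative_at_within[OF \<psi>[OF that]])
    show "(\<psi>' has_real_derivative \<psi>'' x) (at x)" if "\<bar>x\<bar> < 1" for x
      using that by (intro \<psi>2) (auto simp: abs_less_iff)
    show "0 \<le> flow_rhs a b (\<psi>' x) (\<psi>'' x)" if "\<bar>x\<bar> < 1" for x
      using stat[of x] that by (simp add: abs_less_iff)
  qed (use bc init that in auto)
qed

section \<open>Estimates by doubling the space variable\<close>

text \<open>A Lipschitz constant that exceeds the boundary slopes is preserved: where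
  \<open>u(y,t) - u(x,t) - N(y - x)\<close> is maximal and positive, both slopes equal \<open>N\<close>, so the forcing terms
  cancel.  The point is that the bound reaches down to \<open>t = 0\<close>, where the slopes of a classical
  solution might blow up.\<close>

lemma slope_upper_bound_persists:
  assumes S: "sol u ux uxx ut"
    and init: "\<And>x y. -1 \<le> x \<Longrightarrow> x \<le> y \<Longrightarrow> y \<le> 1 \<Longrightarrow> u y 0 - u x 0 \<le> N * (y - x)"
    and ends: "\<And>t. 0 < t \<Longrightarrow> t \<le> \<tau> \<Longrightarrow> u 1 t < N \<and> - u (-1) t < N"
    and x: "x \<in> {-1..1}" and t: "0 < t" "t \<le> \<tau>"
  shows "ux x t \<le> N"
proof -
  define X where "X = {p \<in> {-1..1} \<times> {-1..1}. fst p \<le> (snd p :: real)}"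
  define Z where "Z p t = u (snd p) t - u (fst p) t - N * (snd p - fst p)" for p t
  have "closed {p. fst p \<le> (snd p :: real)}" by (intro closed_Collect_le continuous_intros)
  then have "compact (({-1..1} \<times> {-1..1}) \<inter> {p. fst p \<le> (snd p :: real)})"
    by (intro compact_Int_closed compact_Times compact_Icc)
  then have cX: "compact X" by (simp add: X_def Int_def)
  have Zle: "Z p t \<le> 0" if "p \<in> X" for p
  proof (rule touching_principle[where Z = Z and \<eta> = 1 and ta = 0 and tb = \<tau>, OF cX _ _ _ _ that])
    show "continuous_on (X \<times> {0..\<tau>}) (\<lambda>(p, t). Z p t)"
      unfolding Z_def case_prod_beta
      by (intro continuous_intros continuous_on_solution[OF S]) (auto simp: X_def)
    show "Z p 0 \<le> 0" if "p \<in> X" for p using init that by (auto simp: Z_def X_def)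
    fix p t assume p: "p \<in> X" and t: "0 < t" "t \<le> \<tau>" and pos: "0 < Z p t"
      and mx: "\<And>p'. p' \<in> X \<Longrightarrow> Z p' t \<le> Z p t"
    obtain x y where xy: "p = (x, y)" by (cases p)
    have b: "-1 \<le> x" "x \<le> y" "y \<le> 1" using p by (auto simp: X_def xy)
    have lt: "x < y" using b pos by (cases "x = y") (auto simp: Z_def xy)
    have mxy: "u y' t - N * y' \<le> u y t - N * y" if "x \<le> y'" "y' \<le> 1" for y'
      using mx[of "(x, y')"] that b by (simp add: X_def Z_def xy algebra_simps)
    have mxx: "u x' t - N * x' \<ge> u x t - N * x" if "x' \<le> y" "-1 \<le> x'" for x'
      using mx[of "(x', y)"] that b by (simp add: X_def Z_def xy algebra_simps)
    \<comment> \<open>At \<open>y = 1\<close> the slope would be at least \<open>N\<close>, but there it equals the boundary value.\<close>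
    have y1: "y < 1"
    proof (rule ccontr)
      assume "\<not> y < 1"
      then have y: "y = 1" using b by simp
      have "((\<lambda>y. u y t - N * y) has_real_derivative ux 1 t - N) (at 1 within {-1..1})"
        by (auto intro!: derivative_eq_intros classical_solutionD[OF S t(1)])
      then have "((\<lambda>y. u y t - N * y) has_real_derivative ux 1 t - N) (at 1 within {x..1})"
        using b by (elim DERIV_subset) auto
      from max_at_right_end[OF this] have "ux 1 t - N \<ge> 0" using mxy lt y by auto
      then show False using ends[OF t] classical_solutionD(6)[OF S t(1)] by simp
    qed
    have x1: "-1 < x"
    proof (rule ccontr)
      assume "\<not> -1 < x"
      then have x: "x = -1" using b by simp
      have "((\<lambda>y. N * y - u y t) has_real_derivative N - ux (-1) t) (at (-1) within {-1..1})"
        by (auto intro!: derivative_eq_intros classical_solutionD[OF S t(1)])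
      then have "((\<lambda>y. N * y - u y t) has_real_derivative N - ux (-1) t) (at (-1) within {-1..y})"
        using b by (elim DERIV_subset) auto
      from max_at_left_end[OF this] have "N - ux (-1) t \<le> 0" using mxx lt x by force
      then show False using ends[OF t] classical_solutionD(7)[OF S t(1)] by simp
    qed
    have ab: "\<bar>x\<bar> < 1" "\<bar>y\<bar> < 1" using x1 y1 lt by auto
    have "ut y t \<le> flow_rhs a b N 0"
      by (rule touch_above(2)[OF S ab(2) t(1), of "min (y - x) (1 - y)" "\<lambda>y. N * y"])
        (use lt y1 mxy in \<open>auto intro!: derivative_eq_intros\<close>)
    moreover have "ut x t \<ge> flow_rhs a b N 0"
      by (rule touch_below(2)[OF S ab(1) t(1), of "min (y - x) (x + 1)" "\<lambda>y. N * y"])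
        (use lt x1 mxx in \<open>auto intro!: derivative_eq_intros\<close>)
    ultimately have "ut y t - ut x t \<le> 0" by simp
    moreover have "(Z p has_real_derivative ut y t - ut x t) (at t)"
      unfolding Z_def xy using b
      by (auto intro!: derivative_eq_intros classical_solutionD(2)[OF S t(1)])
    ultimately show "\<exists>D\<le>0. (Z p has_real_derivative D) (at t)" by blast
  qed (use t in auto)
  show ?thesis
  proof (cases "x = 1")
    case True
    then show ?thesis using ends[OF t] classical_solutionD(6)[OF S t(1)] by simp
  next
    case False
    have "ux x t - N \<le> 0"
    proof (rule right_max_deriv_nonpos)
      show "((\<lambda>y. u y t - N * y) has_real_derivative ux x t - N) (at x within {-1..1})"
        using x by (auto intro!: derivative_eq_intros classical_solutionD[OF S t(1)])
      show "1 - x > 0" using False x by auto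
      fix y assume "x < y" "y < x + (1 - x)"
      then show "y \<in> {-1..1} \<and> u y t - N * y \<le> u x t - N * x"
        using Zle[of "(x, y)"] x by (simp add: X_def Z_def algebra_simps)
    qed
    then show ?thesis by simp
  qed
qed

text \<open>A substitute for evenness and monotonicity in \<open>\<bar>x\<bar>\<close>, for a pair of solutions.  At an interior
  maximum of \<open>v(x,t) - w(y,t)\<close> both slopes vanish and the two speeds are on the right sides of the
  speed of a constant; the edges \<open>\<bar>x\<bar> = \<bar>y\<bar>\<close> are covered by hypothesis, and a positive boundary value
  of \<open>w\<close> makes \<open>w\<close> increase outwards at the ends.\<close>

lemma ordered_across_moduli:
  assumes V: "sol v vx vxx vt" and W: "sol w wx wxx wt"
    and diag: "\<And>x y t. x \<in> {-1..1} \<Longrightarrow> \<bar>x\<bar> = \<bar>y\<bar> \<Longrightarrow> t > 0 \<Longrightarrow> v x t < w y t"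
    and ends: "\<And>t. t > 0 \<Longrightarrow> w 1 t > 0 \<and> w (-1) t > 0"
    and init: "\<And>x y. \<bar>x\<bar> \<le> \<bar>y\<bar> \<Longrightarrow> \<bar>y\<bar> \<le> 1 \<Longrightarrow> v x 0 \<le> w y 0"
    and xy: "\<bar>x\<bar> \<le> \<bar>y\<bar>" "\<bar>y\<bar> \<le> 1" and \<tau>: "\<tau> \<ge> 0"
  shows "v x \<tau> \<le> w y \<tau>"
proof -
  define X where "X = {p \<in> {-1..1} \<times> {-1..1}. \<bar>fst p\<bar> \<le> \<bar>snd p :: real\<bar>}"
  define Z where "Z p t = v (fst p) t - w (snd p) t" for p t
  have "closed {p. \<bar>fst p\<bar> \<le> \<bar>snd p :: real\<bar>}" by (intro closed_Collect_le continuous_intros)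
  then have "compact (({-1..1} \<times> {-1..1}) \<inter> {p. \<bar>fst p\<bar> \<le> \<bar>snd p :: real\<bar>})"
    by (intro compact_Int_closed compact_Times compact_Icc)
  then have cX: "compact X" by (simp add: X_def Int_def)
  from xy have "(x, y) \<in> X" by (auto simp: X_def)
  have "Z (x, y) \<tau> \<le> 0"
  proof (rule touching_principle[where Z = Z and \<eta> = 1 and ta = 0 and tb = \<tau>, OF cX _ _ _ _ \<open>(x, y) \<in> X\<close>])
    show "continuous_on (X \<times> {0..\<tau>}) (\<lambda>(p, t). Z p t)"
      unfolding Z_def case_prod_beta
      by (intro continuous_intros continuous_on_solution[OF V] continuous_on_solution[OF W])
        (auto simp: X_def)
    show "Z p 0 \<le> 0" if "p \<in> X" for p using init that by (auto simp: Z_def X_def)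
    fix p t assume p: "p \<in> X" and t: "0 < t" "t \<le> \<tau>" and pos: "0 < Z p t"
      and mx: "\<And>p'. p' \<in> X \<Longrightarrow> Z p' t \<le> Z p t"
    obtain x y where xy: "p = (x, y)" by (cases p)
    have b: "-1 \<le> x" "x \<le> 1" "\<bar>x\<bar> \<le> \<bar>y\<bar>" "-1 \<le> y" "y \<le> 1" using p by (auto simp: X_def xy)
    have lt: "\<bar>x\<bar> < \<bar>y\<bar>" using b pos diag[of x y t] t by (cases "\<bar>x\<bar> = \<bar>y\<bar>") (auto simp: Z_def xy)
    have mxy: "w y t \<le> w y' t" if "\<bar>x\<bar> \<le> \<bar>y'\<bar>" "-1 \<le> y'" "y' \<le> 1" for y'
      using mx[of "(x, y')"] that b by (simp add: X_def Z_def xy)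
    have mxx: "v x' t \<le> v x t" if "\<bar>x'\<bar> \<le> \<bar>y\<bar>" for x'
    proof -
      have "-1 \<le> x'" "x' \<le> 1" using that b by linarith+
      then show ?thesis using mx[of "(x', y)"] that b by (simp add: X_def Z_def xy)
    qed
    have "y \<noteq> 1"
    proof
      assume y: "y = 1"
      have "((\<lambda>y. - w y t) has_real_derivative - wx 1 t) (at 1 within {-1..1})"
        by (auto intro!: derivative_eq_intros classical_solutionD[OF W t(1)])
      then have "((\<lambda>y. - w y t) has_real_derivative - wx 1 t) (at 1 within {\<bar>x\<bar>..1})"
        using b by (elim DERIV_subset) auto
      then have "- wx 1 t \<ge> 0"
      proof (rule max_at_right_end)
        show "- w y' t \<le> - w 1 t" if "y' \<in> {\<bar>x\<bar>..1}" for y'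
        proof -
          have "\<bar>x\<bar> \<le> \<bar>y'\<bar>" "-1 \<le> y'" "y' \<le> 1" using that by auto
          then show ?thesis using mxy y by simp
        qed
      qed (use lt y in simp)
      then show False using ends[OF t(1)] classical_solutionD(6)[OF W t(1)] by simp
    qed
    moreover have "y \<noteq> -1"
    proof
      assume y: "y = -1"
      have "((\<lambda>y. - w y t) has_real_derivative - wx (-1) t) (at (-1) within {-1..1})"
        by (auto intro!: derivative_eq_intros classical_solutionD[OF W t(1)])
      then have "((\<lambda>y. - w y t) has_real_derivative - wx (-1) t) (at (-1) within {-1..-\<bar>x\<bar>})"
        using b by (elim DERIV_subset) auto
      then have "- wx (-1) t \<le> 0"
      proof (rule max_at_left_end)
        show "- w y' t \<le> - w (-1) t" if "y' \<in> {-1..-\<bar>x\<bar>}" for y'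
        proof -
          have "\<bar>x\<bar> \<le> \<bar>y'\<bar>" "-1 \<le> y'" "y' \<le> 1" using that by auto
          then show ?thesis using mxy y by simp
        qed
      qed (use lt y in simp)
      then show False using ends[OF t(1)] classical_solutionD(7)[OF W t(1)] by simp
    qed
    ultimately have ab: "\<bar>x\<bar> < 1" "\<bar>y\<bar> < 1" using lt b by auto
    have near: "\<bar>x\<bar> \<le> \<bar>y'\<bar> \<and> -1 \<le> y' \<and> y' \<le> 1"
      if "\<bar>y' - y\<bar> < min (\<bar>y\<bar> - \<bar>x\<bar>) (1 - \<bar>y\<bar>)" for y' 
      using that abs_triangle_ineq2[of y y'] abs_triangle_ineq2[of y' y] abs_minus_commute[of y y']
        abs_ge_self[of y'] abs_ge_minus_self[of y']
      unfolding min_less_iff_conj by argo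
    then have mxy': "w y t - 0 \<le> w y' t - 0"
      if "\<bar>y' - y\<bar> < min (\<bar>y\<bar> - \<bar>x\<bar>) (1 - \<bar>y\<bar>)" for y'
      using mxy that by simp
    have "wt y t \<ge> flow_rhs a b 0 0"
      by (rule touch_below(2)[OF W ab(2) t(1), of "min (\<bar>y\<bar> - \<bar>x\<bar>) (1 - \<bar>y\<bar>)" "\<lambda>y. 0"])
        ((rule mxy', assumption) | use lt ab in simp)+
    moreover have "vt x t \<le> flow_rhs a b 0 0"
      by (rule touch_above(2)[OF V ab(1) t(1), of "\<bar>y\<bar> - \<bar>x\<bar>" "\<lambda>y. 0"])
        (use lt mxx in auto)
    ultimately have "vt x t - wt y t \<le> 0" by simp
    moreover have "(Z p has_real_derivative vt x t - wt y t) (at t)"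
      unfolding Z_def xy using b
      by (auto intro!: derivative_eq_intros classical_solutionD(2)[OF V t(1)] classical_solutionD(2)[OF W t(1)])
    ultimately show "\<exists>D\<le>0. (Z p has_real_derivative D) (at t)" by blast
  qed (use \<tau> in auto)
  then show ?thesis by (simp add: Z_def)
qed

end

locale even_flow = flow +
  assumes a_even: "a (- p) = a p" and b_even: "b (- p) = b p"
begin

lemma reflected_solution:
  assumes S: "sol u ux uxx ut"
  shows "sol (\<lambda>x. u (- x)) (\<lambda>x t. - ux (- x) t) (\<lambda>x. uxx (- x)) (\<lambda>x. ut (- x))"
proof -
  have 1: "continuous_on ({-1..1} \<times> {0..}) (\<lambda>p. u (- fst p) (snd p))"
    by (rule continuous_on_solution[OF S]) (auto intro!: continuous_intros)
  have "continuous_on ({-1..1} \<times> {0<..}) (\<lambda>p. ux (fst p) (snd p))"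
    using S by (simp add: classical_solution_def case_prod_beta)
  from continuous_on_compose2[OF this, of "{-1..1} \<times> {0<..}" "\<lambda>p. (- fst p, snd p)"]
  have 2: "continuous_on ({-1..1} \<times> {0<..}) (\<lambda>p. - ux (- fst p) (snd p))"
    by (force intro!: continuous_intros)
  have 3: "((\<lambda>y. h (- y)) has_real_derivative - d) (at x within {-1..1})"
    if "(h has_real_derivative d) (at (- x) within {-1..1})" for h :: "real \<Rightarrow> real" and d x
  proof -
    have "(uminus has_real_derivative -1) (at x within {-1..1})" by (auto intro!: derivative_eq_intros)
    from DERIV_image_chain[OF _ this, of h d] that show ?thesis by (simp add: o_def)
  qed
  have 4: "((\<lambda>y. - ux (- y) t) has_real_derivative uxx (- x) t) (at x within {-1..1})"
    if "x \<in> {-1..1}" "t > 0" for x t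
    using S that DERIV_minus[OF 3[of "\<lambda>y. ux y t" "uxx (- x) t" x]]
    by (auto simp: classical_solution_def)
  have 5: "((\<lambda>y. u (- y) t) has_real_derivative - ux (- x) t) (at x within {-1..1})"
    if "x \<in> {-1..1}" "t > 0" for x t
    using S that 3[of "\<lambda>y. u y t" "ux (- x) t" x] by (auto simp: classical_solution_def)
  show ?thesis using S 1 2 4 5 unfolding classical_solution_def case_prod_beta
    by (auto simp: flow_rhs_def a_even b_even)
qed

text \<open>The boundary slopes are the boundary values up to sign, and \<open>u\<close> is bounded on compact time
  intervals; so a large enough constant satisfies the hypotheses of the one-sided lemma for \<open>u\<close>
  and for its reflection.\<close>

lemma slope_bound_persists:
  assumes S: "sol u ux uxx ut"
    and lip: "\<And>x y. -1 \<le> x \<Longrightarrow> x \<le> y \<Longrightarrow> y \<le> 1 \<Longrightarrow> \<bar>u y 0 - u x 0\<bar> \<le> N0 * (y - x)"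
  obtains N where "\<And>x t. x \<in> {-1..1} \<Longrightarrow> 0 < t \<Longrightarrow> t \<le> \<tau> \<Longrightarrow> \<bar>ux x t\<bar> \<le> N"
proof -
  have "compact ({-1..1::real} \<times> {0..\<tau>})" by (intro compact_Times compact_Icc)
  moreover have "continuous_on ({-1..1} \<times> {0..\<tau>}) (\<lambda>p. u (fst p) (snd p))"
    by (intro continuous_on_solution[OF S] continuous_intros) auto
  ultimately have "bounded ((\<lambda>p. u (fst p) (snd p)) ` ({-1..1} \<times> {0..\<tau>}))"
    by (intro compact_imp_bounded compact_continuous_image)
  then obtain K where K: "\<And>x t. x \<in> {-1..1} \<Longrightarrow> t \<in> {0..\<tau>} \<Longrightarrow> \<bar>u x t\<bar> \<le> K"
    unfolding bounded_iff by force
  define N where "N = max N0 (K + 1)"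
  have N: "N0 * d \<le> N * d" if "d \<ge> 0" for d
    using that by (intro mult_right_mono) (auto simp: N_def)
  have ends: "\<bar>u x t\<bar> < N" if "x \<in> {-1..1}" "0 < t" "t \<le> \<tau>" for x t
    using K[of x t] that by (auto simp: N_def)
  have init: "\<bar>u y 0 - u x 0\<bar> \<le> N * (y - x)" if "-1 \<le> x" "x \<le> y" "y \<le> 1" for x y
    using lip[OF that] N[of "y - x"] that by auto
  have "\<bar>ux x t\<bar> \<le> N" if x: "x \<in> {-1..1}" and t: "0 < t" "t \<le> \<tau>" for x t
  proof -
    have "ux x t \<le> N"
      by (rule slope_upper_bound_persists[OF S _ _ x t]) (use init ends in \<open>force simp: abs_less_iff abs_le_iff\<close>)+
    moreover have "- ux (- (- x)) t \<le> N"
    proof (rule slope_upper_bound_persists[OF reflected_solution[OF S] _ _ _ t])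
      show "u (- y) 0 - u (- x) 0 \<le> N * (y - x)" if "-1 \<le> x" "x \<le> y" "y \<le> 1" for x y
        using init[of "- y" "- x"] that by (auto simp: abs_le_iff)
      show "u (- 1) t < N \<and> - u (- (- 1)) t < N" if "0 < t" "t \<le> \<tau>" for t
        using ends[of 1 t] ends[of "-1" t] that by (auto simp: abs_less_iff)
    qed (use x in auto)
    ultimately show ?thesis by (simp add: abs_le_iff)
  qed
  with that show thesis by blast
qed

end

section \<open>The travelling profile\<close>

locale travelling_front = even_flow +
  fixes \<Phi> :: "real \<Rightarrow> real" and c :: real
  assumes b_neg: "b p < 0" and c_pos: "c > 0" and profile: "travelling_profile a b c \<Phi>"
begin

text \<open>Solved for the second derivative, the profile equation is the autonomous first-order equation
  \<open>f' = profile_rate f\<close> for \<open>f = \<Phi>'\<close>.\<close>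

definition profile_rate :: "real \<Rightarrow> real" where
  "profile_rate p = (c - b p * sqrt (1 + p\<^sup>2)) * (1 + p\<^sup>2) / a p"

lemma
  assumes "\<bar>x\<bar> < 1"
  shows profile_deriv: "(\<Phi> has_real_derivative deriv \<Phi> x) (at x)"
    and profile_deriv2: "(deriv \<Phi> has_real_derivative profile_rate (deriv \<Phi> x)) (at x)"
    and profile_speed: "flow_rhs a b (deriv \<Phi> x) (profile_rate (deriv \<Phi> x)) = c"
proof -
  have x: "x \<in> {-1<..<1}" using assms by auto
  then have *: "\<Phi> differentiable (at x)" "deriv \<Phi> differentiable (at x)"
    "c = flow_rhs a b (deriv \<Phi> x) (deriv (deriv \<Phi>) x)"
    using profile by (auto simp: travelling_profile_def profile_ode_def)
  show "(\<Phi> has_real_derivative deriv \<Phi> x) (at x)"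
    using *(1) by (simp add: DERIV_deriv_iff_real_differentiable)
  have pos: "1 + p\<^sup>2 \<noteq> 0" for p :: real by (simp add: add_nonneg_eq_0_iff)
  have rate: "profile_rate (deriv \<Phi> x) = deriv (deriv \<Phi>) x"
    using *(3) a_pos[of "deriv \<Phi> x"] pos by (simp add: profile_rate_def flow_rhs_def field_simps)
  then show "(deriv \<Phi> has_real_derivative profile_rate (deriv \<Phi> x)) (at x)"
    using *(2) by (simp add: DERIV_deriv_iff_real_differentiable)
  show "flow_rhs a b (deriv \<Phi> x) (profile_rate (deriv \<Phi> x)) = c" using *(3) rate by simp
qed

lemma profile_rate_pos: "profile_rate p > 0"
proof -
  have "1 + p\<^sup>2 > 0" by (simp add: add_pos_nonneg)
  moreover from this have "b p * sqrt (1 + p\<^sup>2) < 0" using b_neg by (simp add: mult_neg_pos)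
  ultimately show ?thesis using a_pos[of p] c_pos by (simp add: profile_rate_def)
qed

lemma profile_rate_even: "profile_rate (- p) = profile_rate p"
  by (simp add: profile_rate_def a_even b_even)

lemma profile_slope_strict_mono:
  assumes "-1 < x" "x < y" "y < 1"
  shows "deriv \<Phi> x < deriv \<Phi> y"
proof (rule DERIV_pos_imp_increasing[OF assms(2)])
  fix z assume "x \<le> z" "z \<le> y"
  then have "\<bar>z\<bar> < 1" using assms by auto
  from profile_deriv2[OF this] show "\<exists>l. (deriv \<Phi> has_real_derivative l) (at z) \<and> 0 < l"
    using profile_rate_pos by blast
qed

lemma steep_near_right_end:
  assumes "r0 < 1"
  obtains r where "r0 < r" "r < 1" "deriv \<Phi> r > N"
proof -
  have "eventually (\<lambda>x. deriv \<Phi> x > N) (at_left 1)"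
    using profile by (auto simp: travelling_profile_def filterlim_at_top_dense)
  then have "eventually (\<lambda>x. deriv \<Phi> x > N \<and> x \<in> {r0<..<1}) (at_left 1)"
    using eventually_at_left_real[OF assms] by eventually_elim auto
  from eventually_happens'[OF _ this] show thesis using that by auto
qed

lemma steep_near_left_end:
  obtains r where "-1 < r" "r < 1" "deriv \<Phi> r < N"
proof -
  have "eventually (\<lambda>x. deriv \<Phi> x < N) (at_right (-1))"
    using profile by (auto simp: travelling_profile_def filterlim_at_bot_dense)
  then have "eventually (\<lambda>x. deriv \<Phi> x < N \<and> x \<in> {-1<..<1}) (at_right (-1))"
    using eventually_at_right_real[of "-1::real" 1, simplified] by eventually_elim auto
  from eventually_happens'[OF _ this] show thesis using that by auto
qed

lemma profile_slope_attained: "\<exists>x. \<bar>x\<bar> < 1 \<and> deriv \<Phi> x = p"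
proof -
  obtain y where y: "-1 < y" "y < 1" "deriv \<Phi> y > p" using steep_near_right_end[of "-1" p] by auto
  obtain x where x: "-1 < x" "x < 1" "deriv \<Phi> x < p" using steep_near_left_end[of p] by auto
  have xy: "x < y"
    using profile_slope_strict_mono[of y x] x y by (cases "x = y") force+
  have "continuous_on {x..y} (deriv \<Phi>)"
    by (rule DERIV_continuous_on[where D = "\<lambda>z. profile_rate (deriv \<Phi> z)"],
        rule has_field_derivative_at_within, rule profile_deriv2) (use x y in auto)
  then obtain z where "x \<le> z" "z \<le> y" "deriv \<Phi> z = p"
    using IVT'[of "deriv \<Phi>" x p y] x y xy by auto
  with x y show ?thesis by (intro exI[of _ z]) auto
qed

text \<open>The inverse \<open>X\<close> of \<open>\<Phi>'\<close> is defined on the whole line and has the even derivative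
  \<open>1 / profile_rate\<close>.  Hence \<open>X(p) + X(-p)\<close> is constant, and since \<open>X\<close> tends to \<open>\<plusminus>1\<close> at \<open>\<plusminus>\<infinity>\<close>
  that constant is \<open>0\<close>.\<close>

lemma profile_slope_odd:
  assumes x: "\<bar>x\<bar> < 1"
  shows "deriv \<Phi> (- x) = - deriv \<Phi> x"
proof -
  obtain X where X: "\<And>p. \<bar>X p\<bar> < 1" "\<And>p. deriv \<Phi> (X p) = p"
    using profile_slope_attained by metis
  have inj: "y = z" if "\<bar>y\<bar> < 1" "\<bar>z\<bar> < 1" "deriv \<Phi> y = deriv \<Phi> z" for y z
    using profile_slope_strict_mono[of y z] profile_slope_strict_mono[of z y] that
    by (cases y z rule: linorder_cases) (auto simp: abs_less_iff)
  have Xf: "X (deriv \<Phi> y) = y" if "\<bar>y\<bar> < 1" for y using inj X that by blast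
  have contX: "isCont X p" for p
  proof -
    define d where "d = (1 - \<bar>X p\<bar>) / 2"
    have "d > 0" using X(1)[of p] by (simp add: d_def)
    moreover have "\<bar>z\<bar> < 1" if "\<bar>z - X p\<bar> \<le> d" for z
      using that X(1)[of p] unfolding d_def by argo
    ultimately have d: "d > 0" "\<And>z. \<bar>z - X p\<bar> \<le> d \<Longrightarrow> \<bar>z\<bar> < 1" by auto
    have "isCont X (deriv \<Phi> (X p))"
      by (rule isCont_inverse_function[OF d(1)]) (use Xf d(2) profile_deriv2 in \<open>auto intro: DERIV_isCont\<close>)
    then show ?thesis by (simp add: X)
  qed
  have dX: "(X has_real_derivative inverse (profile_rate p)) (at p)" for p
  proof (rule DERIV_inverse_function[of "deriv \<Phi>"])
    show "(deriv \<Phi> has_real_derivative profile_rate p) (at (X p))"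
      using profile_deriv2[OF X(1)[of p]] by (simp add: X)
    show "profile_rate p \<noteq> 0" using profile_rate_pos[of p] by simp
    show "p - 1 < p" "p < p + 1" by auto
  qed (auto simp: X contX)
  define S where "S p = X p + X (- p)" for p
  have "(S has_real_derivative 0) (at p)" for p
    unfolding S_def by (rule derivative_eq_intros dX DERIV_chain2[OF dX] refl)+ (simp add: profile_rate_even)
  then have Sconst: "S p = S q" for p q using DERIV_isconst_all by blast
  have Szero: "S p = 0" for p
  proof (rule ccontr)
    assume ne: "S p \<noteq> 0"
    define e where "e = min \<bar>S p\<bar> 1 / 2"
    have e: "e > 0" "e < 1" "e < \<bar>S p\<bar>" using ne by (auto simp: e_def)
    \<comment> \<open>Large enough for \<open>X q\<close> and \<open>X (- q)\<close> to be within \<open>e\<close> of the two ends.\<close>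
    define q where "q = max (deriv \<Phi> (1 - e)) (- deriv \<Phi> (e - 1))"
    have "X q \<ge> 1 - e"
      using profile_slope_strict_mono[of "X q" "1 - e"] X(1)[of q] X(2)[of q] e by (force simp: q_def)
    moreover have "X (- q) \<le> e - 1"
      using profile_slope_strict_mono[of "e - 1" "X (- q)"] X(1)[of "- q"] X(2)[of "- q"] e
      by (force simp: q_def)
    ultimately have "\<bar>S q\<bar> \<le> e" using X(1)[of q] X(1)[of "- q"] by (auto simp: S_def)
    with e Sconst[of p q] show False by simp
  qed
  have "X (- deriv \<Phi> x) = - x" using Szero[of "deriv \<Phi> x"] Xf[OF x] by (simp add: S_def)
  then show ?thesis using X(2)[of "- deriv \<Phi> x"] by simp
qed

lemma profile_even:
  assumes x: "\<bar>x\<bar> < 1"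
  shows "\<Phi> (- x) = \<Phi> x"
proof -
  have "\<Phi> x - \<Phi> (- x) = \<Phi> 0 - \<Phi> (- 0)"
  proof (rule DERIV_isconst3[of "-1" 1 x 0 "\<lambda>x. \<Phi> x - \<Phi> (- x)"])
    fix y :: real assume "y \<in> {-1<..<1}"
    then have y: "\<bar>y\<bar> < 1" "\<bar>- y\<bar> < 1" by auto
    show "((\<lambda>x. \<Phi> x - \<Phi> (- x)) has_real_derivative 0) (at y)"
      by (rule derivative_eq_intros profile_deriv y DERIV_chain2[OF profile_deriv] refl)+
        (simp add: profile_slope_odd y)
  qed (use x in auto)
  then show ?thesis by simp
qed

lemma profile_abs: "\<bar>x\<bar> < 1 \<Longrightarrow> \<Phi> \<bar>x\<bar> = \<Phi> x"
  using profile_even[of x] by (cases "x < 0") auto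

lemma profile_slope_nonneg:
  assumes "0 \<le> x" "x < 1"
  shows "deriv \<Phi> x \<ge> 0"
  using profile_slope_odd[of 0] profile_slope_strict_mono[of 0 x] assms by (cases "x = 0") auto

text \<open>The derivative of \<open>\<Phi>(pz)\<close> is \<open>p \<Phi>'(pz)\<close>, which for \<open>z \<ge> 0\<close> lies between \<open>0\<close> and \<open>\<Phi>'(z)\<close>, because
  \<open>\<Phi>'\<close> is nonnegative and increasing there; evenness covers the other signs.  This is what makes the
  contracted profile \<open>\<rho>\<close> flatter than \<open>\<Phi>\<close>.\<close>

lemma contracted_profile_increment:
  assumes p: "0 \<le> p" "p \<le> 1" and xy: "\<bar>x\<bar> \<le> \<bar>y\<bar>" "\<bar>y\<bar> < 1"
  shows "0 \<le> \<Phi> (p * y) - \<Phi> (p * x)" "\<Phi> (p * y) - \<Phi> (p * x) \<le> \<Phi> y - \<Phi> x"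
proof -
  have small: "\<bar>p * z\<bar> < 1" if "\<bar>z\<bar> < 1" for z
    using mult_left_le_one_le[of "\<bar>z\<bar>" p] p that by (simp add: abs_mult)
  have eq: "\<Phi> (p * z) = \<Phi> (p * \<bar>z\<bar>)" if "\<bar>z\<bar> < 1" for z
    using profile_abs[OF small[OF that]] p by (simp add: abs_mult)
  have d: "((\<lambda>z. \<Phi> (p * z)) has_real_derivative deriv \<Phi> (p * z) * p) (at z)" if "\<bar>z\<bar> < 1" for z
    by (rule derivative_eq_intros DERIV_chain2[OF profile_deriv] small that refl)+ simp
  have pz: "0 \<le> p * z" "p * z \<le> z" "p * z < 1" if "0 \<le> z" "z < 1" for z
    using p that mult_left_le_one_le[of z p] by auto
  have "\<Phi> (p * \<bar>x\<bar>) \<le> \<Phi> (p * \<bar>y\<bar>)"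
  proof (rule DERIV_nonneg_imp_nondecreasing[OF xy(1)])
    fix z assume z: "\<bar>x\<bar> \<le> z" "z \<le> \<bar>y\<bar>"
    then have "0 \<le> z" "z < 1" using xy by auto
    then show "\<exists>d. ((\<lambda>z. \<Phi> (p * z)) has_real_derivative d) (at z) \<and> 0 \<le> d"
      using d[of z] profile_slope_nonneg[of "p * z"] pz[of z] p
      by (intro exI[of _ "deriv \<Phi> (p * z) * p"] conjI) auto
  qed
  then show "0 \<le> \<Phi> (p * y) - \<Phi> (p * x)" using eq[of x] eq[of y] xy by linarith
  have "\<Phi> \<bar>x\<bar> - \<Phi> (p * \<bar>x\<bar>) \<le> \<Phi> \<bar>y\<bar> - \<Phi> (p * \<bar>y\<bar>)"
  proof (rule DERIV_nonneg_imp_nondecreasing[OF xy(1)])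
    fix z assume z: "\<bar>x\<bar> \<le> z" "z \<le> \<bar>y\<bar>"
    then have z: "0 \<le> z" "z < 1" using xy by auto
    have "deriv \<Phi> (p * z) * p \<le> deriv \<Phi> (p * z)"
      using p profile_slope_nonneg pz[OF z] by (intro mult_left_le) auto
    also have "\<dots> \<le> deriv \<Phi> z"
      using profile_slope_strict_mono[of "p * z" z] pz[OF z] z
      by (cases "p * z < z") (linarith, metis order_antisym_conv linorder_not_less order_refl)
    finally show "\<exists>d. ((\<lambda>z. \<Phi> z - \<Phi> (p * z)) has_real_derivative d) (at z) \<and> 0 \<le> d"
      using z by (intro exI[of _ "deriv \<Phi> z - deriv \<Phi> (p * z) * p"] conjI derivative_intros profile_deriv d) auto
  qed
  then show "\<Phi> (p * y) - \<Phi> (p * x) \<le> \<Phi> y - \<Phi> x" 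
    using eq[of x] eq[of y] profile_abs[of x] profile_abs[of y] xy by linarith
qed

text \<open>The doubled form of the slope comparison with \<open>\<Phi>'\<close>.  At an interior maximum of
  \<open>v(y,t) - w(x,t) - \<Phi>(y) + \<Phi>(x)\<close> the speeds are at most and at least \<open>c\<close>, so the difference does not grow.
  The slope of \<open>v\<close> is bounded while \<open>\<Phi>'\<close> is infinite at \<open>\<plusminus>1\<close>, hence the domain can be cut at a radius
  \<open>r < 1\<close> where no maximum sits.  The edges \<open>\<bar>x\<bar> = \<bar>y\<bar>\<close> are covered by hypothesis.\<close>

lemma increment_below_profile:
  assumes V: "sol v vx vxx vt" and W: "sol w wx wxx wt"
    and diag: "\<And>x y t. x \<in> {-1..1} \<Longrightarrow> \<bar>x\<bar> = \<bar>y\<bar> \<Longrightarrow> t > 0 \<Longrightarrow> v x t < w y t"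
    and slope: "\<And>x t. x \<in> {-1..1} \<Longrightarrow> 0 < t \<Longrightarrow> t \<le> \<tau> \<Longrightarrow> \<bar>vx x t\<bar> \<le> N"
    and init: "\<And>x y. \<bar>x\<bar> \<le> \<bar>y\<bar> \<Longrightarrow> \<bar>y\<bar> < 1 \<Longrightarrow> v y 0 - w x 0 \<le> \<Phi> y - \<Phi> x"
    and xy: "\<bar>x\<bar> \<le> \<bar>y\<bar>" "\<bar>y\<bar> < 1" and \<tau>: "\<tau> \<ge> 0"
  shows "v y \<tau> - w x \<tau> \<le> \<Phi> y - \<Phi> x"
proof -
  obtain r where r: "\<bar>y\<bar> < r" "r < 1" "deriv \<Phi> r > N" using steep_near_right_end xy(2) by blast
  have r0: "r > 0" "\<bar>r\<bar> < 1" "\<bar>- r\<bar> < 1" using r by auto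
  define X where "X = {p \<in> {-r..r} \<times> {-r..r}. \<bar>fst p\<bar> \<le> \<bar>snd p\<bar>}"
  define Z where "Z p t = v (snd p) t - w (fst p) t - \<Phi> (snd p) + \<Phi> (fst p)" for p t
  have "closed {p. \<bar>fst p\<bar> \<le> \<bar>snd p :: real\<bar>}" by (intro closed_Collect_le continuous_intros)
  then have "compact (({-r..r} \<times> {-r..r}) \<inter> {p. \<bar>fst p\<bar> \<le> \<bar>snd p :: real\<bar>})"
    by (intro compact_Int_closed compact_Times compact_Icc)
  then have cX: "compact X" by (simp add: X_def Int_def)
  have cont: "continuous_on {-r..r} \<Phi>"
    by (rule DERIV_continuous_on[where D = "deriv \<Phi>"], rule has_field_derivative_at_within,
        rule profile_deriv) (use r0 r in auto)
  from xy r have "(x, y) \<in> X" by (auto simp: X_def)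
  have "Z (x, y) \<tau> \<le> 0"
  proof (rule touching_principle[where Z = Z and \<eta> = 1 and ta = 0 and tb = \<tau>, OF cX _ _ _ _ \<open>(x, y) \<in> X\<close>])
    have "continuous_on (X \<times> {0..\<tau>}) (\<lambda>q. \<Phi> (snd (fst q)))" "continuous_on (X \<times> {0..\<tau>}) (\<lambda>q. \<Phi> (fst (fst q)))"
      by (rule continuous_on_compose2[OF cont], auto intro!: continuous_intros simp: X_def)+
    then show "continuous_on (X \<times> {0..\<tau>}) (\<lambda>(p, t). Z p t)"
      unfolding Z_def case_prod_beta
      by (intro continuous_intros continuous_on_solution[OF V] continuous_on_solution[OF W])
        (use r in \<open>auto simp: X_def\<close>)
    show "Z p 0 \<le> 0" if "p \<in> X" for p
    proof -
      have "\<bar>fst p\<bar> \<le> \<bar>snd p\<bar>" "\<bar>snd p\<bar> < 1" using that r by (auto simp: X_def)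
      from init[OF this] show ?thesis by (simp add: Z_def)
    qed
    fix p t assume p: "p \<in> X" and t: "0 < t" "t \<le> \<tau>" and pos: "0 < Z p t"
      and mx: "\<And>p'. p' \<in> X \<Longrightarrow> Z p' t \<le> Z p t"
    obtain x y where xy: "p = (x, y)" by (cases p)
    have b: "\<bar>x\<bar> \<le> \<bar>y\<bar>" "-r \<le> y" "y \<le> r" "\<bar>y\<bar> < 1" "\<bar>x\<bar> < 1" using p r by (auto simp: X_def xy)
    have lt: "\<bar>x\<bar> < \<bar>y\<bar>"
    proof (rule ccontr)
      assume "\<not> ?thesis"
      then have eq: "\<bar>y\<bar> = \<bar>x\<bar>" using b by simp
      have "y \<in> {-1..1}" using b by auto
      then have "v y t < w x t" using diag[OF _ eq t(1)] by simp
      moreover have "\<Phi> y = \<Phi> x" using profile_abs[of x] profile_abs[of y] eq b by simp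
      ultimately show False using pos by (simp add: Z_def xy)
    qed
    have mxy: "v y' t - \<Phi> y' \<le> v y t - \<Phi> y" if "\<bar>x\<bar> \<le> \<bar>y'\<bar>" "-r \<le> y'" "y' \<le> r" for y'
    proof -
      have "(x, y') \<in> X" using that p by (auto simp: X_def xy)
      from mx[OF this] show ?thesis by (simp add: Z_def xy)
    qed
    have mxx: "w x t - \<Phi> x \<le> w x' t - \<Phi> x'" if "\<bar>x'\<bar> \<le> \<bar>y\<bar>" for x'
    proof -
      have "(x', y) \<in> X" using that b unfolding X_def by auto
      from mx[OF this] show ?thesis by (simp add: Z_def xy)
    qed
    have dvy: "((\<lambda>y. v y t - \<Phi> y) has_real_derivative vx z t - deriv \<Phi> z) (at z)" if "\<bar>z\<bar> < 1" for z
      by (intro derivative_intros profile_deriv classical_solutionD(3)[OF V t(1)] that)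
    have vN: "\<bar>vx r t\<bar> \<le> N" "\<bar>vx (- r) t\<bar> \<le> N" using slope[of r t] slope[of "- r" t] t r0 r by auto
    have "y \<noteq> r"
    proof
      assume y: "y = r"
      have "vx r t - deriv \<Phi> r \<ge> 0"
      proof (rule left_max_deriv_nonneg[OF dvy])
        show "r - \<bar>x\<bar> > 0" using lt y r0 by simp
        show "y' \<in> UNIV \<and> v y' t - \<Phi> y' \<le> v r t - \<Phi> r" if "r - (r - \<bar>x\<bar>) < y'" "y' < r" for y'
          using mxy[of y'] that y by auto
      qed (use r0 in simp)
      with vN r show False by simp
    qed
    moreover have "y \<noteq> - r"
    proof
      assume y: "y = - r"
      have "vx (- r) t - deriv \<Phi> (- r) \<le> 0"
      proof (rule right_max_deriv_nonpos[OF dvy])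
        show "r - \<bar>x\<bar> > 0" using lt y r0 by simp
        show "y' \<in> UNIV \<and> v y' t - \<Phi> y' \<le> v (- r) t - \<Phi> (- r)"
          if "- r < y'" "y' < - r + (r - \<bar>x\<bar>)" for y'
          using mxy[of y'] that y by auto
      qed (use r0 in simp)
      with vN r profile_slope_odd[OF r0(2)] show False by simp
    qed
    ultimately have yr: "\<bar>y\<bar> < r" using b by auto
    define e where "e = min (\<bar>y\<bar> - \<bar>x\<bar>) (r - \<bar>y\<bar>)"
    have e: "e > 0" using lt yr by (simp add: e_def)
    have near: "\<bar>x\<bar> \<le> \<bar>y'\<bar>" "-r \<le> y'" "y' \<le> r" "\<bar>y'\<bar> < 1" if "\<bar>y' - y\<bar> < e" for y'
      using that abs_triangle_ineq2[of y y'] abs_triangle_ineq2[of y' y] abs_minus_commute[of y y']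
        abs_ge_self[of y'] abs_ge_minus_self[of y'] r
      unfolding e_def min_less_iff_conj by argo+
    define e' where "e' = \<bar>y\<bar> - \<bar>x\<bar>"
    have e': "e' > 0" using lt by (simp add: e'_def)
    have near': "\<bar>x'\<bar> \<le> \<bar>y\<bar>" "\<bar>x'\<bar> < 1" if "\<bar>x' - x\<bar> < e'" for x'
      using that abs_triangle_ineq2[of x' x] b unfolding e'_def by linarith+
    have "vt y t \<le> c"
      using touch_above(2)[OF V b(4) t(1) e profile_deriv profile_deriv2[OF b(4)] mxy] near
        profile_speed[OF b(4)] by simp
    moreover have "wt x t \<ge> c"
      using touch_below(2)[OF W b(5) t(1) e' profile_deriv profile_deriv2[OF b(5)] mxx] near'
        profile_speed[OF b(5)] by simp
    ultimately have "vt y t - wt x t \<le> 0" by simp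
    moreover have "(Z p has_real_derivative vt y t - wt x t) (at t)"
      unfolding Z_def xy using b
      by (auto intro!: derivative_eq_intros classical_solutionD(2)[OF V t(1)] classical_solutionD(2)[OF W t(1)])
    ultimately show "\<exists>D\<le>0. (Z p has_real_derivative D) (at t)" by blast
  qed (use \<tau> in auto)
  then show ?thesis by (simp add: Z_def)
qed

text \<open>As \<open>\<Phi>\<close> is infinitely steep at \<open>\<plusminus>1\<close>, a function of bounded slope cannot touch \<open>\<Phi> + K + ct\<close> from
  below near the ends.  At an interior contact point its speed is at most \<open>c\<close>.\<close>

lemma below_travelling_wave:
  assumes V: "sol v vx vxx vt"
    and slope: "\<And>x t. x \<in> {-1..1} \<Longrightarrow> 0 < t \<Longrightarrow> t \<le> \<tau> \<Longrightarrow> \<bar>vx x t\<bar> \<le> N"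
    and init: "\<And>y. \<bar>y\<bar> < 1 \<Longrightarrow> v y 0 \<le> \<Phi> y + K"
    and y: "\<bar>y\<bar> < 1" and \<tau>: "\<tau> \<ge> 0"
  shows "v y \<tau> \<le> \<Phi> y + K + c * \<tau>"
proof -
  obtain r where r: "\<bar>y\<bar> < r" "r < 1" "deriv \<Phi> r > N" using steep_near_right_end y by blast
  have r0: "r > 0" "\<bar>r\<bar> < 1" "\<bar>- r\<bar> < 1" using r by auto
  define Z where "Z y t = v y t - \<Phi> y - K - c * t" for y t
  have cont: "continuous_on {-r..r} \<Phi>"
    by (rule DERIV_continuous_on[where D = "deriv \<Phi>"], rule has_field_derivative_at_within,
        rule profile_deriv) (use r0 r in auto)
  from r have "y \<in> {-r..r}" by auto
  have "Z y \<tau> \<le> 0"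
  proof (rule touching_principle[where Z = Z and \<eta> = 1 and ta = 0 and tb = \<tau>, OF compact_Icc _ _ _ _ \<open>y \<in> {-r..r}\<close>])
    have "continuous_on ({-r..r} \<times> {0..\<tau>}) (\<lambda>q. \<Phi> (fst q))"
      by (rule continuous_on_compose2[OF cont]) (auto intro!: continuous_intros)
    then show "continuous_on ({-r..r} \<times> {0..\<tau>}) (\<lambda>(p, t). Z p t)"
      unfolding Z_def case_prod_beta
      by (intro continuous_intros continuous_on_solution[OF V]) (use r in auto)
    show "Z p 0 \<le> 0" if "p \<in> {-r..r}" for p
    proof -
      have "\<bar>p\<bar> < 1" using that r by auto
      from init[OF this] show ?thesis by (simp add: Z_def)
    qed
    fix y t assume yr: "y \<in> {-r..r}" and t: "0 < t" "t \<le> \<tau>"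
      and mx: "\<And>p'. p' \<in> {-r..r} \<Longrightarrow> Z p' t \<le> Z y t"
    have mxy: "v y' t - \<Phi> y' \<le> v y t - \<Phi> y" if "-r \<le> y'" "y' \<le> r" for y'
      using mx[of y'] that by (simp add: Z_def)
    have dvy: "((\<lambda>y. v y t - \<Phi> y) has_real_derivative vx z t - deriv \<Phi> z) (at z)" if "\<bar>z\<bar> < 1" for z
      by (intro derivative_intros profile_deriv classical_solutionD(3)[OF V t(1)] that)
    have vN: "\<bar>vx r t\<bar> \<le> N" "\<bar>vx (- r) t\<bar> \<le> N" using slope[of r t] slope[of "- r" t] t r0 r by auto
    have "y \<noteq> r"
    proof
      assume y: "y = r"
      have "vx r t - deriv \<Phi> r \<ge> 0"
        by (rule left_max_deriv_nonneg[OF dvy, where e = r]) (use r0 mxy y in auto)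
      with vN r show False by simp
    qed
    moreover have "y \<noteq> - r"
    proof
      assume y: "y = - r"
      have "vx (- r) t - deriv \<Phi> (- r) \<le> 0"
        by (rule right_max_deriv_nonpos[OF dvy, where e = r]) (use r0 mxy y in auto)
      with vN r profile_slope_odd[OF r0(2)] show False by simp
    qed
    ultimately have yr: "\<bar>y\<bar> < r" "\<bar>y\<bar> < 1" using yr r by auto
    define e where "e = r - \<bar>y\<bar>"
    have e: "e > 0" using yr by (simp add: e_def)
    have near: "-r \<le> y'" "y' \<le> r" "\<bar>y'\<bar> < 1" if "\<bar>y' - y\<bar> < e" for y'
      using that r unfolding e_def by linarith+
    have "vt y t \<le> c"
      using touch_above(2)[OF V yr(2) t(1) e profile_deriv profile_deriv2[OF yr(2)] mxy] near
        profile_speed[OF yr(2)] by simp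
    moreover have "(Z y has_real_derivative vt y t - c) (at t)"
      unfolding Z_def using yr
      by (auto intro!: derivative_eq_intros classical_solutionD(2)[OF V t(1)])
    ultimately show "\<exists>D\<le>0. (Z y has_real_derivative D) (at t)" by (intro exI[of _ "vt y t - c"]) simp
  qed (use \<tau> in auto)
  then show ?thesis by (simp add: Z_def)
qed

end

section \<open>The interior slope estimate\<close>

definition diffusivity :: "(real \<Rightarrow> real) \<Rightarrow> real \<Rightarrow> real" where
  "diffusivity a p = a p / (1 + p\<^sup>2)"

definition forcing :: "(real \<Rightarrow> real) \<Rightarrow> real \<Rightarrow> real" where
  "forcing b p = b p * sqrt (1 + p\<^sup>2)"

lemma flow_rhs_eq: "flow_rhs a b p q = diffusivity a p * q + forcing b p"
  by (simp add: flow_rhs_def diffusivity_def forcing_def)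

text \<open>Take \<open>\<Psi>(s) = ln (1 + s / d) / E\<close>.  It solves \<open>\<Psi>'' = - E (\<Psi>')\<^sup>2\<close>, its slope stays above \<open>m\<close> on an interval
  whose length depends on \<open>E\<close> and \<open>m\<close> alone, and its rise there is as large as desired when \<open>d\<close> is
  small.  The quadratic rate of concavity matches the decay of the diffusivity, which is of order
  \<open>1 / P\<^sup>2\<close> at slope \<open>P\<close>.\<close>

lemma steep_concave_modulus:
  fixes E m C :: real
  assumes E: "E > 0" and m: "m > 0"
  obtains \<Psi> \<Psi>' s0 where "s0 > 0" "\<Psi> 0 = 0" "\<Psi> s0 \<ge> C"
    "\<And>s. 0 \<le> s \<Longrightarrow> (\<Psi> has_real_derivative \<Psi>' s) (at s)"
    "\<And>s. 0 \<le> s \<Longrightarrow> (\<Psi>' has_real_derivative - E * (\<Psi>' s)\<^sup>2) (at s)"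
    "\<And>s. 0 \<le> s \<Longrightarrow> s \<le> s0 \<Longrightarrow> m \<le> \<Psi>' s"
    "\<And>s. 0 \<le> s \<Longrightarrow> s \<le> s0 \<Longrightarrow> m * s \<le> \<Psi> s"
proof -
  \<comment> \<open>Both \<open>s0\<close> and \<open>d\<close> are at most \<open>1 / (2 E m)\<close>, so the slope \<open>1 / (E (s + d))\<close> is at least \<open>m\<close> up to \<open>s0\<close>.\<close>
  define s0 where "s0 = 1 / (2 * E * m)"
  define d where "d = s0 * exp (- (E * \<bar>C\<bar>))"
  define \<Psi> where "\<Psi> s = (ln (s + d) - ln d) / E" for s
  define \<Psi>' where "\<Psi>' s = 1 / (E * (s + d))" for s
  have s0: "s0 > 0" using E m by (simp add: s0_def)
  have d: "d > 0" "d \<le> s0" using s0 E by (auto simp: d_def mult_le_cancel_left1)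
  have sd: "s + d > 0" "s + d \<noteq> 0" "E * (s + d) > 0" "E * (s + d) \<noteq> 0" if "0 \<le> s" for s
    using that d E by auto
  have d1: "(\<Psi> has_real_derivative \<Psi>' s) (at s)" if "0 \<le> s" for s
    unfolding \<Psi>_def \<Psi>'_def using sd[OF that] E
    by (auto intro!: derivative_eq_intros simp: divide_simps)
  have d2: "(\<Psi>' has_real_derivative - E * (\<Psi>' s)\<^sup>2) (at s)" if "0 \<le> s" for s
    unfolding \<Psi>'_def using sd[OF that] E
    by (auto intro!: derivative_eq_intros simp: divide_simps power2_eq_square)
  have ge: "m \<le> \<Psi>' s" if "0 \<le> s" "s \<le> s0" for s
  proof -
    have "E * (s + d) \<le> E * (2 * s0)" using that d E by (intro mult_left_mono) auto
    also have "\<dots> = 1 / m" using E m by (simp add: s0_def)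
    finally show ?thesis
      using m sd(3)[OF that(1)] pos_le_divide_eq[of m "E * (s + d)" 1] pos_le_divide_eq[of "E * (s + d)" m 1]
      by (simp add: \<Psi>'_def mult.commute)
  qed
  have \<Psi>0: "\<Psi> 0 = 0" by (simp add: \<Psi>_def)
  have lin: "m * s \<le> \<Psi> s" if "0 \<le> s" "s \<le> s0" for s
  proof -
    have "\<Psi> 0 - m * 0 \<le> \<Psi> s - m * s"
    proof (rule DERIV_nonneg_imp_nondecreasing[OF that(1)])
      fix x assume "0 \<le> x" "x \<le> s"
      then show "\<exists>y. ((\<lambda>s. \<Psi> s - m * s) has_real_derivative y) (at x) \<and> 0 \<le> y"
        using ge[of x] that
        by (intro exI[of _ "\<Psi>' x - m"] conjI) (auto intro!: derivative_eq_intros d1)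
    qed
    then show ?thesis using \<Psi>0 by simp
  qed
  have "E * \<bar>C\<bar> = ln s0 - ln d"
    using s0 by (simp add: d_def ln_mult)
  also have "\<dots> \<le> ln (s0 + d) - ln d" using s0 d by simp
  finally have "\<bar>C\<bar> \<le> \<Psi> s0" using E by (simp add: \<Psi>_def field_simps)
  then have "C \<le> \<Psi> s0" by simp
  from that[OF s0 \<Psi>0 this d1 d2 ge lin] show thesis by blast
qed

locale lipschitz_flow = flow +
  fixes a0 L :: real
  assumes a0_pos: "a0 > 0" and a_ge: "a0 \<le> a p" and L_nonneg: "L \<ge> 0"
    and diffusivity_lipschitz: "\<bar>diffusivity a p - diffusivity a q\<bar> \<le> L * \<bar>p - q\<bar>"
    and forcing_lipschitz: "\<bar>forcing b p - forcing b q\<bar> \<le> L * \<bar>p - q\<bar>"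
begin

lemma diffusivity_ge:
  assumes "\<bar>p\<bar> \<le> K"
  shows "diffusivity a p \<ge> a0 / (1 + K\<^sup>2)"
proof -
  have "p\<^sup>2 \<le> K\<^sup>2" using assms by (metis abs_le_square_iff abs_ge_zero abs_of_nonneg order_trans)
  then show ?thesis unfolding diffusivity_def using a_ge[of p] a0_pos
    by (intro frac_le) (auto simp: add_pos_nonneg)
qed

text \<open>The speeds at the two ends of a steep chord.  The slopes there differ from \<open>P\<close> by the slopes
  \<open>d1\<close> and \<open>d2\<close> of the penalties.  As both slopes are at most \<open>2P\<close>, the diffusivity is at least
  \<open>a0 / (5 P\<^sup>2)\<close>, so the two diffusion terms together win \<open>8 \<kappa> L\<close>; this pays for the difference of the
  forcing terms, whose arguments are at most \<open>8 \<kappa>\<close> apart.\<close>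

lemma steep_pair_contracts:
  assumes k: "\<kappa> \<ge> 0" and P: "P \<ge> 1" "P \<ge> 4 * \<kappa>"
    and d: "\<bar>d1\<bar> \<le> 4 * \<kappa>" "\<bar>d2\<bar> \<le> 4 * \<kappa>"
    and E: "E \<ge> 2 * \<kappa> + 20 * \<kappa> * L / a0"
  shows "flow_rhs a b (P + d1) (- E * P\<^sup>2 + 2 * \<kappa>) \<le> flow_rhs a b (P - d2) (E * P\<^sup>2 - 2 * \<kappa>)"
proof -
  have P2: "P\<^sup>2 \<ge> 1" using P by simp
  define Q where "Q = E * P\<^sup>2 - 2 * \<kappa>"
  have "2 * \<kappa> * 1 \<le> 2 * \<kappa> * P\<^sup>2" using P2 k by (intro mult_left_mono) auto
  moreover have "(2 * \<kappa> + 20 * \<kappa> * L / a0) * P\<^sup>2 \<le> E * P\<^sup>2" using E P2 by (intro mult_right_mono) auto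
  ultimately have Q: "Q \<ge> 20 * \<kappa> * L / a0 * P\<^sup>2" by (simp add: Q_def algebra_simps)
  have Q0: "Q \<ge> 0"
    using order_trans[OF _ Q] k L_nonneg a0_pos by simp
  have dif: "diffusivity a p * Q \<ge> 4 * \<kappa> * L" if "\<bar>p\<bar> \<le> 2 * P" for p
  proof -
    have "a0 / (5 * P\<^sup>2) \<le> a0 / (1 + (2 * P)\<^sup>2)"
      using P2 a0_pos by (intro frac_le) (auto simp: power_mult_distrib add_pos_nonneg)
    also have "\<dots> \<le> diffusivity a p" using diffusivity_ge[OF that] .
    finally have "a0 / (5 * P\<^sup>2) * (20 * \<kappa> * L / a0 * P\<^sup>2) \<le> diffusivity a p * Q"
      using Q Q0 a0_pos k L_nonneg a_pos[of p]
      by (intro mult_mono) (auto simp: diffusivity_def add_pos_nonneg less_imp_le)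
    moreover have "a0 / (5 * P\<^sup>2) * (20 * \<kappa> * L / a0 * P\<^sup>2) = 4 * \<kappa> * L"
      using a0_pos P by (simp add: field_simps)
    ultimately show ?thesis by simp
  qed
  have "diffusivity a (P + d1) * Q \<ge> 4 * \<kappa> * L" "diffusivity a (P - d2) * Q \<ge> 4 * \<kappa> * L"
    using P d by (intro dif; linarith)+
  moreover have "forcing b (P + d1) - forcing b (P - d2) \<le> L * (8 * \<kappa>)"
  proof -
    have "\<bar>forcing b (P + d1) - forcing b (P - d2)\<bar> \<le> L * \<bar>(P + d1) - (P - d2)\<bar>"
      by (rule forcing_lipschitz)
    also have "\<dots> \<le> L * (8 * \<kappa>)" using d L_nonneg by (intro mult_left_mono) auto
    finally show ?thesis by simp
  qed
  moreover have "L * (8 * \<kappa>) = 2 * (4 * \<kappa> * L)" by simp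
  moreover have "- E * P\<^sup>2 + 2 * \<kappa> = - Q" "E * P\<^sup>2 - 2 * \<kappa> = Q" by (simp_all add: Q_def)
  ultimately show ?thesis unfolding flow_rhs_eq by (simp only: mult_minus_right)
qed

text \<open>For a centre \<open>x\<^sub>0\<close> at distance at least \<open>\<epsilon>\<close> from \<open>\<plusminus>r\<close>, consider
  \<open>u(y,t) - u(x,t) - \<Psi>(y - x) - \<kappa>(x - x\<^sub>0)\<^sup>2 - \<kappa>(y - x\<^sub>0)\<^sup>2\<close> on pairs \<open>x \<le> y \<le> x + s\<^sub>0\<close> in \<open>[-r,r]\<close>.  It is
  nonpositive on the diagonal; where \<open>y - x = s\<^sub>0\<close> the modulus, and where \<open>\<bar>x\<bar> = r\<close> or \<open>\<bar>y\<bar> = r\<close> a penalty,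
  makes up for the oscillation; at the initial time \<open>\<Psi>\<close> is at least as steep as \<open>u\<close>.  At interior maxima it does
  not grow, by \<open>steep_pair_contracts\<close>.  Letting \<open>y\<close> tend to \<open>x = x\<^sub>0\<close> gives \<open>u\<^sub>x \<le> \<Psi>'(0)\<close>, a bound that
  depends neither on \<open>x\<^sub>0\<close> nor on the time.\<close>

lemma interior_slope_estimate:
  assumes S: "sol u ux uxx ut" and s: "s > 0" and \<epsilon>: "\<epsilon> > 0" and r: "r < 1"
    and osc: "\<And>x y t. t \<ge> s \<Longrightarrow> \<bar>x\<bar> \<le> r \<Longrightarrow> \<bar>y\<bar> \<le> r \<Longrightarrow> u y t - u x t \<le> C"
  obtains K where "\<And>x t. t \<ge> s \<Longrightarrow> \<bar>x\<bar> \<le> r - \<epsilon> \<Longrightarrow> ux x t \<le> K"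
proof -
  have "continuous_on ({-1..1} \<times> {0<..}) (\<lambda>p. ux (fst p) (snd p))"
    using S by (simp add: classical_solution_def case_prod_beta)
  from continuous_on_compose2[OF this, of "{-1..1}" "\<lambda>x. (x, s)"]
  have "continuous_on {-1..1} (\<lambda>x. ux x s)" using s by (force intro!: continuous_intros)
  then have "bounded ((\<lambda>x. ux x s) ` {-1..1})"
    by (intro compact_imp_bounded compact_continuous_image) auto
  then obtain N where "\<forall>z \<in> (\<lambda>x. ux x s) ` {-1..1}. norm z \<le> N" unfolding bounded_iff by blast
  then have N: "\<And>x. x \<in> {-1..1} \<Longrightarrow> \<bar>ux x s\<bar> \<le> N" by auto
  \<comment> \<open>The penalty reaches the oscillation at distance \<open>\<epsilon>\<close> from the centre.\<close>
  define \<kappa> where "\<kappa> = \<bar>C\<bar> / \<epsilon>\<^sup>2"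
  \<comment> \<open>At least as steep as the initial slopes and as the penalties, whose slopes are at most \<open>4 \<kappa>\<close>.\<close>
  define m where "m = max 1 (max N (4 * \<kappa>))"
  define E where "E = 2 * \<kappa> + 20 * \<kappa> * L / a0 + 1"
  have k: "\<kappa> \<ge> 0" and k\<epsilon>: "\<kappa> * \<epsilon>\<^sup>2 = \<bar>C\<bar>" using \<epsilon> by (auto simp: \<kappa>_def)
  have E: "E > 0" using k L_nonneg a0_pos by (simp add: E_def add_nonneg_pos)
  have m: "m > 0" "m \<ge> 1" "m \<ge> N" "m \<ge> 4 * \<kappa>" by (auto simp: m_def)
  obtain \<Psi> \<Psi>' s0 where s0: "s0 > 0" and \<Psi>0: "\<Psi> 0 = 0" and \<Psi>s0: "\<Psi> s0 \<ge> \<bar>C\<bar>"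
    and d1: "\<And>s. 0 \<le> s \<Longrightarrow> (\<Psi> has_real_derivative \<Psi>' s) (at s)"
    and d2: "\<And>s. 0 \<le> s \<Longrightarrow> (\<Psi>' has_real_derivative - E * (\<Psi>' s)\<^sup>2) (at s)"
    and \<Psi>m: "\<And>s. 0 \<le> s \<Longrightarrow> s \<le> s0 \<Longrightarrow> m \<le> \<Psi>' s"
    and lin: "\<And>s. 0 \<le> s \<Longrightarrow> s \<le> s0 \<Longrightarrow> m * s \<le> \<Psi> s"
    by (rule steep_concave_modulus[OF E m(1), where C = "\<bar>C\<bar>"], (rule that; assumption))
  have \<Psi>nn: "\<Psi> s \<ge> 0" if "0 \<le> s" "s \<le> s0" for s
    using order_trans[OF _ lin[OF that]] m that by simp
  have cont\<Psi>: "continuous_on {0..} \<Psi>"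
    by (rule DERIV_continuous_on[where D = \<Psi>'], rule has_field_derivative_at_within, rule d1) auto
  define X where "X = {p \<in> {-r..r} \<times> {-r..r}. fst p \<le> snd p \<and> snd p \<le> fst p + s0}"
  have "closed ({p. fst p \<le> (snd p :: real)} \<inter> {p. snd p \<le> fst p + s0})"
    by (intro closed_Int closed_Collect_le continuous_intros)
  then have "compact (({-r..r} \<times> {-r..r}) \<inter> ({p. fst p \<le> (snd p :: real)} \<inter> {p. snd p \<le> fst p + s0}))"
    by (intro compact_Int_closed compact_Times compact_Icc)
  moreover have "X = ({-r..r} \<times> {-r..r}) \<inter> ({p. fst p \<le> (snd p :: real)} \<inter> {p. snd p \<le> fst p + s0})"
    by (auto simp: X_def)
  ultimately have cX: "compact X" by simp
  have doubled: "u y \<tau> - u x \<tau> \<le> \<Psi> (y - x) + \<kappa> * (x - x0)\<^sup>2 + \<kappa> * (y - x0)\<^sup>2"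
    if x0: "\<bar>x0\<bar> \<le> r - \<epsilon>" and xy: "(x, y) \<in> X" and \<tau>: "\<tau> \<ge> s" for x0 x y \<tau>
  proof -
    define Z where "Z p t = u (snd p) t - u (fst p) t - \<Psi> (snd p - fst p)
      - \<kappa> * (fst p - x0)\<^sup>2 - \<kappa> * (snd p - x0)\<^sup>2" for p t
    have far: "\<kappa> * (z - x0)\<^sup>2 \<ge> \<bar>C\<bar>" if "\<bar>z\<bar> = r" for z
    proof -
      have "\<epsilon> \<le> \<bar>z - x0\<bar>" using that x0 by linarith
      then have "\<epsilon>\<^sup>2 \<le> (z - x0)\<^sup>2" using \<epsilon> by (metis abs_le_square_iff abs_of_pos)
      then show ?thesis using k k\<epsilon> by (metis mult_left_mono)
    qed
    have "Z (x, y) \<tau> \<le> 0"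
    proof (rule touching_principle[where Z = Z and \<eta> = 1 and ta = s and tb = \<tau>, OF cX _ _ _ _ xy])
      have "continuous_on (X \<times> {s..\<tau>}) (\<lambda>q. \<Psi> (snd (fst q) - fst (fst q)))"
        by (rule continuous_on_compose2[OF cont\<Psi>]) (auto intro!: continuous_intros simp: X_def)
      then show "continuous_on (X \<times> {s..\<tau>}) (\<lambda>(p, t). Z p t)"
        unfolding Z_def case_prod_beta
        by (intro continuous_intros continuous_on_solution[OF S]) (use r s in \<open>auto simp: X_def\<close>)
      show "Z p s \<le> 0" if p: "p \<in> X" for p
      proof -
        obtain x y where xy: "p = (x, y)" by (cases p)
        have b: "-1 < x" "x \<le> y" "y < 1" "y - x \<le> s0" using p r by (auto simp: X_def xy)
        have "u y s - N * y \<le> u x s - N * x"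
        proof (rule DERIV_nonpos_imp_nonincreasing[OF b(2)])
          fix z assume "x \<le> z" "z \<le> y"
          then have z: "\<bar>z\<bar> < 1" "z \<in> {-1..1}" using b by auto
          show "\<exists>d. ((\<lambda>z. u z s - N * z) has_real_derivative d) (at z) \<and> d \<le> 0"
            using N[OF z(2)] classical_solutionD(3)[OF S s z(1)]
            by (intro exI[of _ "ux z s - N"] conjI) (auto intro!: derivative_eq_intros)
        qed
        moreover have "N * (y - x) \<le> m * (y - x)" using m b by (intro mult_right_mono) auto
        moreover have "m * (y - x) \<le> \<Psi> (y - x)" using lin b by simp
        moreover have "\<kappa> * (x - x0)\<^sup>2 \<ge> 0" "\<kappa> * (y - x0)\<^sup>2 \<ge> 0" using k by auto
        ultimately show ?thesis by (simp add: Z_def xy algebra_simps)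
      qed
      fix p t assume p: "p \<in> X" and t: "s < t" "t \<le> \<tau>" and pos: "0 < Z p t"
        and mx: "\<And>p'. p' \<in> X \<Longrightarrow> Z p' t \<le> Z p t"
      have t0: "t > 0" using s t by simp
      obtain x y where xy: "p = (x, y)" by (cases p)
      have b: "-r \<le> x" "x \<le> y" "y \<le> r" "y - x \<le> s0" using p by (auto simp: X_def xy)
      have oscC: "u y t - u x t \<le> \<bar>C\<bar>" using osc[of t x y] t b abs_ge_self[of C] by (simp add: abs_le_iff)
      have nn: "\<kappa> * (x - x0)\<^sup>2 \<ge> 0" "\<kappa> * (y - x0)\<^sup>2 \<ge> 0" "\<Psi> (y - x) \<ge> 0" using k \<Psi>nn b by auto
      have pos': "u y t - u x t > \<Psi> (y - x) + \<kappa> * (x - x0)\<^sup>2 + \<kappa> * (y - x0)\<^sup>2"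
        using pos by (simp add: Z_def xy)
      have "y \<noteq> x" using pos' nn \<Psi>0 by auto
      moreover have "y - x \<noteq> s0" using pos' nn \<Psi>s0 oscC by auto
      moreover have "\<bar>x\<bar> \<noteq> r" "\<bar>y\<bar> \<noteq> r" using pos' nn far[of x] far[of y] oscC by auto
      ultimately have lt: "x < y" "y - x < s0" "\<bar>x\<bar> < r" "\<bar>y\<bar> < r" using b by auto
      have mx': "u y' t - u x' t - \<Psi> (y' - x') - \<kappa> * (x' - x0)\<^sup>2 - \<kappa> * (y' - x0)\<^sup>2
        \<le> u y t - u x t - \<Psi> (y - x) - \<kappa> * (x - x0)\<^sup>2 - \<kappa> * (y - x0)\<^sup>2"
        if "-r \<le> x'" "x' \<le> y'" "y' \<le> r" "y' \<le> x' + s0" for x' y'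
      proof -
        have "(x', y') \<in> X" using that by (auto simp: X_def)
        from mx[OF this] show ?thesis by (simp add: Z_def xy)
      qed
      define e where "e = min (min (y - x) (s0 - (y - x))) (min (r - \<bar>x\<bar>) (r - \<bar>y\<bar>))"
      have e: "e > 0" using lt by (simp add: e_def)
      have ee: "e \<le> y - x" "e \<le> s0 - (y - x)" "e \<le> r - \<bar>x\<bar>" "e \<le> r - \<bar>y\<bar>" by (auto simp: e_def)
      have neary: "x \<le> y'" "y' \<le> r" "y' \<le> x + s0" if "\<bar>y' - y\<bar> < e" for y'
        using that ee by linarith+
      have nearx: "-r \<le> x'" "x' \<le> y" "y \<le> x' + s0" if "\<bar>x' - x\<bar> < e" for x'
        using that ee by linarith+
      have ab: "\<bar>x\<bar> < 1" "\<bar>y\<bar> < 1" using lt r by auto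
      define P where "P = \<Psi>' (y - x)"
      have "ut y t \<le> flow_rhs a b (P + 2 * \<kappa> * (y - x0)) (- E * P\<^sup>2 + 2 * \<kappa>)"
        unfolding P_def
      proof (rule touch_above(2)[OF S ab(2) t0 e, of "\<lambda>y. \<Psi> (y - x) + \<kappa> * (y - x0)\<^sup>2"])
        show "((\<lambda>y. \<Psi> (y - x) + \<kappa> * (y - x0)\<^sup>2) has_real_derivative \<Psi>' (y' - x) + 2 * \<kappa> * (y' - x0)) (at y')"
          if "\<bar>y' - y\<bar> < e" for y'
          using neary[OF that] by (auto intro!: derivative_eq_intros DERIV_chain2[OF d1])
        show "((\<lambda>y. \<Psi>' (y - x) + 2 * \<kappa> * (y - x0)) has_real_derivative - E * (\<Psi>' (y - x))\<^sup>2 + 2 * \<kappa>) (at y)"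
          using lt by (auto intro!: derivative_eq_intros DERIV_chain2[OF d2])
        show "u y' t - (\<Psi> (y' - x) + \<kappa> * (y' - x0)\<^sup>2) \<le> u y t - (\<Psi> (y - x) + \<kappa> * (y - x0)\<^sup>2)"
          if "\<bar>y' - y\<bar> < e" for y' using mx'[of x y'] neary[OF that] b by simp
      qed
      also have "\<dots> \<le> flow_rhs a b (P - 2 * \<kappa> * (x - x0)) (E * P\<^sup>2 - 2 * \<kappa>)"
      proof (rule steep_pair_contracts[OF k])
        show "P \<ge> 1" "P \<ge> 4 * \<kappa>" using \<Psi>m[of "y - x"] lt m by (auto simp: P_def)
        have "\<bar>x0\<bar> < 1" using x0 \<epsilon> r by simp
        then have "\<bar>x - x0\<bar> \<le> 2" "\<bar>y - x0\<bar> \<le> 2" using ab by linarith+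
        then show "\<bar>2 * \<kappa> * (y - x0)\<bar> \<le> 4 * \<kappa>" "\<bar>2 * \<kappa> * (x - x0)\<bar> \<le> 4 * \<kappa>"
          using k mult_left_mono[of "\<bar>y - x0\<bar>" 2 "2 * \<kappa>"] mult_left_mono[of "\<bar>x - x0\<bar>" 2 "2 * \<kappa>"]
          by (auto simp: abs_mult)
      qed (simp add: E_def)
      also have "\<dots> \<le> ut x t"
        unfolding P_def
      proof (rule touch_below(2)[OF S ab(1) t0 e, of "\<lambda>x. - \<Psi> (y - x) - \<kappa> * (x - x0)\<^sup>2"])
        show "((\<lambda>x. - \<Psi> (y - x) - \<kappa> * (x - x0)\<^sup>2) has_real_derivative \<Psi>' (y - x') - 2 * \<kappa> * (x' - x0)) (at x')"
          if "\<bar>x' - x\<bar> < e" for x'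
          using nearx[OF that] by (auto intro!: derivative_eq_intros DERIV_chain2[OF d1])
        show "((\<lambda>x. \<Psi>' (y - x) - 2 * \<kappa> * (x - x0)) has_real_derivative E * (\<Psi>' (y - x))\<^sup>2 - 2 * \<kappa>) (at x)"
          using lt by (auto intro!: derivative_eq_intros DERIV_chain2[OF d2])
        show "u x' t - (- \<Psi> (y - x') - \<kappa> * (x' - x0)\<^sup>2) \<ge> u x t - (- \<Psi> (y - x) - \<kappa> * (x - x0)\<^sup>2)"
          if "\<bar>x' - x\<bar> < e" for x' using mx'[of x' y] nearx[OF that] b by simp
      qed
      finally have "ut y t - ut x t \<le> 0" by simp
      moreover have "(Z p has_real_derivative ut y t - ut x t) (at t)"
        unfolding Z_def xy using ab
        by (auto intro!: derivative_eq_intros classical_solutionD(2)[OF S t0])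
      ultimately show "\<exists>D\<le>0. (Z p has_real_derivative D) (at t)" by blast
    qed (use \<tau> in auto)
    then show ?thesis by (simp add: Z_def)
  qed
  have "ux x t \<le> \<Psi>' 0" if t: "t \<ge> s" and x: "\<bar>x\<bar> \<le> r - \<epsilon>" for x t
  proof -
    have ux: "((\<lambda>y. u y t) has_real_derivative ux x t) (at x)"
      using classical_solutionD(3)[OF S, of t x] t s x \<epsilon> r by simp
    have "((\<lambda>y. y - x) has_real_derivative 1) (at x)" by (auto intro!: derivative_eq_intros)
    from DERIV_chain2[OF _ this, of \<Psi>] d1[of 0]
    have "((\<lambda>y. \<Psi> (y - x)) has_real_derivative \<Psi>' 0) (at x)" by simp
    then have "((\<lambda>y. u y t - \<Psi> (y - x) - \<kappa> * (y - x)\<^sup>2) has_real_derivative ux x t - \<Psi>' 0) (at x)"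
      by (auto intro!: derivative_eq_intros ux)
    then have "ux x t - \<Psi>' 0 \<le> 0"
    proof (rule right_max_deriv_nonpos)
      show "min s0 \<epsilon> > 0" using s0 \<epsilon> by simp
      fix y assume y: "x < y" "y < x + min s0 \<epsilon>"
      have "(x, y) \<in> X" using y x \<epsilon> by (auto simp: X_def)
      from doubled[OF x this t] show "y \<in> UNIV \<and> u y t - \<Psi> (y - x) - \<kappa> * (y - x)\<^sup>2
        \<le> u x t - \<Psi> (x - x) - \<kappa> * (x - x)\<^sup>2" by (simp add: \<Psi>0)
    qed
    then show ?thesis by simp
  qed
  with that show thesis by blast
qed

section \<open>Unbounded growth of the slopes\<close>

lemma stationary_curvature_bound:
  assumes stat: "flow_rhs a b p q = 0" and p: "\<bar>p\<bar> \<le> R"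
  shows "\<bar>q\<bar> \<le> (\<bar>forcing b 0\<bar> + L * R) / (a0 / (1 + R\<^sup>2))"
proof -
  have dif: "diffusivity a p > 0" using a_pos[of p] by (simp add: diffusivity_def add_pos_nonneg)
  have "\<bar>forcing b p\<bar> \<le> \<bar>forcing b 0\<bar> + \<bar>forcing b p - forcing b 0\<bar>" by simp
  also have "\<dots> \<le> \<bar>forcing b 0\<bar> + L * R"
    using order_trans[OF forcing_lipschitz[of p 0] mult_left_mono[of "\<bar>p - 0\<bar>" R L]] p L_nonneg by simp
  finally have f: "\<bar>forcing b p\<bar> \<le> \<bar>forcing b 0\<bar> + L * R" .
  have "q = - forcing b p / diffusivity a p" using stat dif by (simp add: flow_rhs_eq field_simps)
  then have "\<bar>q\<bar> = \<bar>forcing b p\<bar> / diffusivity a p" using dif by simp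
  also have "\<dots> \<le> (\<bar>forcing b 0\<bar> + L * R) / (a0 / (1 + R\<^sup>2))"
    using f diffusivity_ge[OF p] a0_pos by (intro frac_le) (auto simp: add_pos_nonneg)
  finally show ?thesis .
qed

text \<open>Suppose all slopes after time \<open>s\<close> are bounded by \<open>K\<close>.  Then the equation is uniformly parabolic along
  \<open>u\<close>, and the gap \<open>z = u - \<phi>\<close> satisfies a linear inequality with bounded first-order coefficient.
  The function \<open>\<eta> cosh(kx) + \<eta>k(t - s)\<close> is a subsolution of it once \<open>k\<close> is large: the second
  derivative of \<open>cosh(kx)\<close> dominates the first.  For small \<open>\<eta>\<close> its outward slope at \<open>\<plusminus>1\<close> is below
  \<open>\<delta>\<close>, while that of \<open>z\<close> is at least \<open>z \<ge> \<delta>\<close>.  Hence \<open>z\<close> grows linearly in time, and so does \<open>u(1,t)\<close>,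
  which is itself a slope.\<close>

lemma unbounded_slopes:
  assumes S: "sol u ux uxx ut"
    and \<phi>: "\<And>x. x \<in> {-1..1} \<Longrightarrow> (\<phi> has_real_derivative \<phi>' x) (at x)"
    and \<phi>2: "\<And>x. x \<in> {-1..1} \<Longrightarrow> (\<phi>' has_real_derivative \<phi>'' x) (at x)"
    and stat: "\<And>x. x \<in> {-1..1} \<Longrightarrow> flow_rhs a b (\<phi>' x) (\<phi>'' x) = 0"
    and Q: "\<And>x. x \<in> {-1..1} \<Longrightarrow> \<bar>\<phi>'' x\<bar> \<le> Q"
    and bc: "\<phi>' 1 \<le> \<phi> 1" "\<phi>' (-1) \<ge> - \<phi> (-1)"
    and \<delta>: "\<delta> > 0" and gap: "\<And>x t. x \<in> {-1..1} \<Longrightarrow> t \<ge> 0 \<Longrightarrow> \<phi> x + \<delta> \<le> u x t"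
    and s: "s > 0"
  shows "\<exists>t\<ge>s. \<exists>x\<in>{-1..1}. \<bar>ux x t\<bar> > K"
proof (rule ccontr)
  assume "\<not> ?thesis"
  then have K: "\<bar>ux x t\<bar> \<le> K" if "t \<ge> s" "x \<in> {-1..1}" for x t using that by force
  define \<alpha> where "\<alpha> = a0 / (1 + K\<^sup>2)"
  have \<alpha>: "\<alpha> > 0" using a0_pos by (simp add: \<alpha>_def add_pos_nonneg)
  have Q0: "Q \<ge> 0" using Q[of 0] by simp
  \<comment> \<open>With this \<open>k\<close> diffusion exceeds the first-order terms by at least \<open>\<eta> k cosh(kx)\<close>.\<close>
  define k where "k = (L * (Q + 1) + 1) / \<alpha>"
  have k: "k > 0" "\<alpha> * k = L * (Q + 1) + 1" using \<alpha> L_nonneg Q0 by (auto simp: k_def add_nonneg_pos)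
  define c where "c = cosh k * (k + 1)"
  define \<eta> where "\<eta> = \<delta> / (2 * c)"
  have c: "c > 0" using k cosh_real_pos[of k] unfolding c_def by (intro mult_pos_pos) auto
  have \<eta>: "\<eta> > 0" using \<delta> c by (simp add: \<eta>_def)
  have "\<eta> * c = \<delta> / 2" using c by (simp add: \<eta>_def)
  then have \<eta>k: "\<eta> * cosh k * (k + 1) < \<delta>" using \<delta> by (simp add: c_def)
  have \<eta>1: "\<eta> * cosh k < \<delta>" "\<eta> * k * cosh k < \<delta>"
    using \<eta>k mult_pos_pos[OF \<eta> cosh_real_pos[of k]] mult_pos_pos[OF mult_pos_pos[OF \<eta> cosh_real_pos[of k]] k(1)]
    by (simp_all add: algebra_simps)
  have sinh_le: "\<bar>sinh z\<bar> \<le> cosh z" for z :: real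
    using sinh_le_cosh_real[of z] sinh_le_cosh_real[of "- z"] by (simp add: abs_le_iff)
  have cosh1: "cosh z \<ge> 1" for z :: real by (rule cosh_real_ge_1)
  define Z where "Z x t = \<eta> * cosh (k * x) + \<eta> * k * (t - s) - (u x t - \<phi> x)" for x t
  have \<phi>cont: "continuous_on {-1..1} \<phi>"
    by (rule DERIV_continuous_on[where D = \<phi>'], rule has_field_derivative_at_within, rule \<phi>)
  have Zle: "Z x \<tau> \<le> 0" if x: "x \<in> {-1..1}" and \<tau>: "\<tau> \<ge> s" for x \<tau>
  proof (rule touching_principle[where Z = Z and \<eta> = 1 and ta = s and tb = \<tau>, OF compact_Icc _ _ _ _ x])
    have "continuous_on ({-1..1} \<times> {s..\<tau>}) (\<lambda>q. \<phi> (fst q))"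
      by (rule continuous_on_compose2[OF \<phi>cont]) (auto intro!: continuous_intros)
    then show "continuous_on ({-1..1} \<times> {s..\<tau>}) (\<lambda>(p, t). Z p t)"
      unfolding Z_def case_prod_beta
      by (intro continuous_intros continuous_on_solution[OF S]) (use s in auto)
    show "Z p s \<le> 0" if "p \<in> {-1..1}" for p
    proof -
      have "\<bar>k * p\<bar> \<le> \<bar>k\<bar>" using that k by (simp add: abs_mult mult_left_le abs_le_iff)
      then have "cosh (k * p) \<le> cosh k"
        using cosh_real_nonneg_le_iff[of "\<bar>k * p\<bar>" "\<bar>k\<bar>"] by (simp add: cosh_real_abs)
      then have "\<eta> * cosh (k * p) \<le> \<eta> * cosh k" using \<eta> by simp
      then show ?thesis using gap[OF that, of s] \<eta>1 s by (simp add: Z_def)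
    qed
    fix x t assume x: "x \<in> {-1..1}" and t: "s < t" "t \<le> \<tau>"
      and mx: "\<And>p'. p' \<in> {-1..1} \<Longrightarrow> Z p' t \<le> Z x t"
    have t0: "t > 0" using t s by simp
    have mxx: "u x t - (\<phi> x + \<eta> * cosh (k * x)) \<le> u y t - (\<phi> y + \<eta> * cosh (k * y))"
      if "y \<in> {-1..1}" for y using mx[OF that] by (simp add: Z_def)
    have mxx': "\<phi> y + \<eta> * cosh (k * y) - u y t \<le> \<phi> x + \<eta> * cosh (k * x) - u x t"
      if "y \<in> {-1..1}" for y using mxx[OF that] by simp
    have g1: "((\<lambda>y. \<phi> y + \<eta> * cosh (k * y)) has_real_derivative \<phi>' y + \<eta> * k * sinh (k * y)) (at y)"
      if "y \<in> {-1..1}" for y by (auto intro!: derivative_eq_intros \<phi> that)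
    have g2: "((\<lambda>y. \<phi>' y + \<eta> * k * sinh (k * y)) has_real_derivative \<phi>'' y + \<eta> * k\<^sup>2 * cosh (k * y)) (at y)"
      if "y \<in> {-1..1}" for y
      using that by (auto intro!: derivative_eq_intros \<phi>2 simp: power2_eq_square)
    have dx: "((\<lambda>y. \<phi> y + \<eta> * cosh (k * y) - u y t) has_real_derivative \<phi>' x + \<eta> * k * sinh (k * x) - ux x t)
        (at x within {-1..1})"
      using x by (intro derivative_intros has_field_derivative_at_within[OF g1] classical_solutionD(1)[OF S t0]) auto
    have sk: "\<eta> * k * sinh k < \<delta>"
    proof -
      have "\<eta> * k * sinh k \<le> \<eta> * k * cosh k"
        using \<eta> k sinh_le[of k] by (intro mult_left_mono) auto
      with \<eta>1 show ?thesis by simp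
    qed
    have "x \<noteq> 1"
    proof
      assume x: "x = 1"
      have "\<phi>' 1 + \<eta> * k * sinh (k * 1) - ux 1 t \<ge> 0"
        by (rule max_at_right_end[OF dx[unfolded x]]) (use mxx' x in auto)
      then show False
        using classical_solutionD(6)[OF S t0] gap[of 1 t] bc(1) sk t0 by simp
    qed
    moreover have "x \<noteq> -1"
    proof
      assume x: "x = -1"
      have "\<phi>' (-1) + \<eta> * k * sinh (k * (-1)) - ux (-1) t \<le> 0"
        by (rule max_at_left_end[OF dx[unfolded x]]) (use mxx' x in auto)
      then show False
        using classical_solutionD(7)[OF S t0] gap[of "-1" t] bc(2) sk t0 by simp
    qed
    ultimately have x1: "\<bar>x\<bar> < 1" using x by auto
    have near: "y \<in> {-1..1}" if "\<bar>y - x\<bar> < 1 - \<bar>x\<bar>" for y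
    proof -
      have "-1 \<le> y" "y \<le> 1" using that by linarith+
      then show ?thesis by simp
    qed
    define p q where "p = \<phi>' x + \<eta> * k * sinh (k * x)" and "q = \<phi>'' x + \<eta> * k\<^sup>2 * cosh (k * x)"
    have e: "1 - \<bar>x\<bar> > 0" using x1 by simp
    have touch: "ux x t = p" "ut x t \<ge> flow_rhs a b p q"
      using touch_below(1,2)[OF S x1 t0 e g1 g2[OF x] mxx] near by (auto simp: p_def q_def)
    define h where "h = \<eta> * k * cosh (k * x)"
    have h: "h \<ge> \<eta> * k" using \<eta> k cosh1[of "k * x"] by (simp add: h_def)
    have qh: "q = \<phi>'' x + h * k" by (simp add: q_def h_def power2_eq_square)
    have pd: "\<bar>p - \<phi>' x\<bar> \<le> h"
      using sinh_le[of "k * x"] \<eta> k by (simp add: p_def h_def abs_mult)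
    have Lh: "L * \<bar>p - \<phi>' x\<bar> \<le> L * h" using pd L_nonneg by (intro mult_left_mono) auto
    have "diffusivity a p \<ge> \<alpha>" using diffusivity_ge[of p K] K[of t x] touch t x by (simp add: \<alpha>_def)
    then have d1: "diffusivity a p * (h * k) \<ge> \<alpha> * (h * k)"
      using h \<eta> k by (intro mult_right_mono mult_nonneg_nonneg) (auto intro: order_trans[OF _ h])
    have "\<bar>(diffusivity a p - diffusivity a (\<phi>' x)) * \<phi>'' x\<bar> \<le> L * h * Q"
      unfolding abs_mult using order_trans[OF diffusivity_lipschitz Lh] Q[OF x] L_nonneg h \<eta> k
      by (intro mult_mono) (auto intro!: mult_nonneg_nonneg order_trans[OF _ h])
    then have d2: "(diffusivity a p - diffusivity a (\<phi>' x)) * \<phi>'' x \<ge> - (L * h * Q)" by simp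
    have d3: "forcing b p - forcing b (\<phi>' x) \<ge> - (L * h)"
      using order_trans[OF forcing_lipschitz Lh] by simp
    have "flow_rhs a b p q = flow_rhs a b p q - flow_rhs a b (\<phi>' x) (\<phi>'' x)" using stat[OF x] by simp
    also have "\<dots> = diffusivity a p * (h * k) + (diffusivity a p - diffusivity a (\<phi>' x)) * \<phi>'' x
      + (forcing b p - forcing b (\<phi>' x))"
      by (simp add: flow_rhs_eq qh algebra_simps)
    also have "\<dots> \<ge> \<alpha> * (h * k) - L * h * Q - L * h" using d1 d2 d3 by simp
    also have "\<alpha> * (h * k) - L * h * Q - L * h = h * (\<alpha> * k) - L * h * Q - L * h" by simp
    also have "\<dots> = h" unfolding k(2) by (simp add: algebra_simps)
    finally have "ut x t \<ge> \<eta> * k" using touch(2) h by simp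
    moreover have "(Z x has_real_derivative \<eta> * k - ut x t) (at t)"
      unfolding Z_def using x by (auto intro!: derivative_eq_intros classical_solutionD(2)[OF S t0])
    ultimately show "\<exists>D\<le>0. (Z x has_real_derivative D) (at t)"
      by (intro exI[of _ "\<eta> * k - ut x t"]) simp
  qed (use \<tau> in auto)
  \<comment> \<open>A time at which the lower barrier at \<open>x = 1\<close> has passed \<open>K\<close>.\<close>
  define t where "t = s + (\<bar>K\<bar> + \<bar>\<phi> 1\<bar> + 1) / (\<eta> * k)"
  have t: "t \<ge> s" "\<eta> * k * (t - s) = \<bar>K\<bar> + \<bar>\<phi> 1\<bar> + 1" using \<eta> k by (auto simp: t_def)
  have "Z 1 t \<le> 0" using Zle t by simp
  moreover have "\<eta> * cosh (k * 1) \<ge> 0" using \<eta> cosh1[of "k * 1"] by simp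
  ultimately have "u 1 t \<ge> \<bar>K\<bar> + 1" using t unfolding Z_def by linarith
  with K[of t 1] t s classical_solutionD(6)[OF S, of t] show False by simp
qed

end

section \<open>Oscillation and slope bounds for the sandwiched solution\<close>

locale front_problem = travelling_front + lipschitz_flow
begin

text \<open>Write \<open>s = t - 2T\<close>.  The chain is \<open>u(y,t) < v(y,s+3T) \<le> \<Phi>(y) + v(0,s+T) + 3cT\<close> and
  \<open>v(0,s+T) \<le> v(x,s+2T) < u(x,t)\<close>.  Its second link is the travelling-wave barrier started at time \<open>s\<close>,
  whose initial height is the increment bound with \<open>x = 0\<close>; the third is the ordering across
  moduli.\<close>

lemma oscillation_bound:
  assumes U: "sol u ux uxx ut" and V: "sol v vx vxx vt" and T: "T > 0"
    and p: "0 \<le> p" "p < 1"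
    and v0: "\<And>x. x \<in> {-1..1} \<Longrightarrow> v x 0 = \<Phi> (p * x) + M"
    and init: "\<And>x. x \<in> {-1..1} \<Longrightarrow> v x 0 < u x 0" "\<And>x. x \<in> {-1..1} \<Longrightarrow> u x 0 < v x T"
    and ends: "\<And>t. t > 0 \<Longrightarrow> v 1 t > 0 \<and> v (-1) t > 0"
    and t: "t \<ge> 2 * T" and x: "x \<in> {-1..1}" and y: "\<bar>y\<bar> < 1"
  shows "u y t - u x t \<le> \<Phi> y + 3 * c * T"
proof -
  note W = time_shift_solution[OF V less_imp_le[OF T]]
  have vu: "v x t < u x t" if "x \<in> {-1..1}" "t \<ge> 0" for x t
    by (rule solutions_ordered[OF U V init(1) that])
  have uv: "u x t < v x (t + T)" if "x \<in> {-1..1}" "t \<ge> 0" for x t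
    by (rule solutions_ordered[OF W U _ that]) (simp add: init(2))
  have small: "\<bar>p * z\<bar> < 1" "\<bar>p * z\<bar> \<le> p" if "z \<in> {-1..1}" for z
  proof -
    have "\<bar>p * z\<bar> \<le> p" using that p by (auto simp: abs_mult abs_le_iff intro!: mult_left_le)
    then show "\<bar>p * z\<bar> < 1" "\<bar>p * z\<bar> \<le> p" using p by auto
  qed
  have refl: "v (- x) t < v x (t + T)" if "x \<in> {-1..1}" "t \<ge> 0" for x t
  proof (rule solutions_ordered[OF W reflected_solution[OF V] _ that])
    fix x :: real assume x: "x \<in> {-1..1}"
    then have "v (- x) 0 = v x 0" using v0[of x] v0[of "- x"] profile_even[OF small(1)[OF x]] by simp
    then show "v (- x) 0 < v x (0 + T)" using init[OF x] by simp
  qed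
  \<comment> \<open>The two edges \<open>y = x\<close> and \<open>y = - x\<close> of the doubled domain.\<close>
  have diag: "v x t < v y (t + T)" if "x \<in> {-1..1}" "\<bar>x\<bar> = \<bar>y\<bar>" "t \<ge> 0" for x y t
  proof (cases "y = x")
    case True
    then show ?thesis using vu[OF that(1,3)] uv[OF that(1,3)] by simp
  next
    case False
    then have "y = - x" using that(2) by (simp add: abs_eq_iff)
    then show ?thesis using refl[of y t] that by simp
  qed
  \<comment> \<open>Because \<open>p < 1\<close>, the contracted profile stays away from the infinite slopes.\<close>
  have lip: "\<bar>v y 0 - v x 0\<bar> \<le> deriv \<Phi> p * (y - x)" if "-1 \<le> x" "x \<le> y" "y \<le> 1" for x y
  proof -
    have slope: "\<bar>deriv \<Phi> q\<bar> \<le> deriv \<Phi> p" if "\<bar>q\<bar> \<le> p" for q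
    proof -
      have q: "- p \<le> q" "q \<le> p" using that by auto
      have "deriv \<Phi> q \<le> deriv \<Phi> p"
        using profile_slope_strict_mono[of q p] q p by (cases "q = p") auto
      moreover have "- deriv \<Phi> p \<le> deriv \<Phi> q"
        using profile_slope_strict_mono[of "- p" q] profile_slope_odd[of p] q p
        by (cases "q = - p") auto
      ultimately show ?thesis by (simp add: abs_le_iff)
    qed
    have "norm (\<Phi> (p * y) - \<Phi> (p * x)) \<le> deriv \<Phi> p * norm (y - x)"
    proof (rule field_differentiable_bound[OF convex_real_interval(5)[of "-1" 1]])
      fix z :: real assume z': "z \<in> {-1..1}"
      have "((\<lambda>z. p * z) has_real_derivative p) (at z)" by (auto intro!: derivative_eq_intros)
      from DERIV_chain2[OF profile_deriv[OF small(1)[OF z']] this]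
      show "((\<lambda>z. \<Phi> (p * z)) has_real_derivative deriv \<Phi> (p * z) * p) (at z within {-1..1})"
        by (rule has_field_derivative_at_within)
      have "\<bar>deriv \<Phi> (p * z)\<bar> * p \<le> \<bar>deriv \<Phi> (p * z)\<bar>" using p by (intro mult_left_le) auto
      also have "\<dots> \<le> deriv \<Phi> p" by (rule slope[OF small(2)[OF z']])
      finally show "norm (deriv \<Phi> (p * z) * p) \<le> deriv \<Phi> p" using p by (simp add: abs_mult)
    qed (use that in auto)
    then show ?thesis using v0[of x] v0[of y] that by simp
  qed
  have A: "v y t - v x (t + T) \<le> \<Phi> y - \<Phi> x" if "\<bar>x\<bar> \<le> \<bar>y\<bar>" "\<bar>y\<bar> < 1" "t \<ge> 0" for x y t
  proof -
    obtain N where N: "\<And>x s. x \<in> {-1..1} \<Longrightarrow> 0 < s \<Longrightarrow> s \<le> t \<Longrightarrow> \<bar>vx x s\<bar> \<le> N"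
      using slope_bound_persists[OF V lip] by blast
    show ?thesis
    proof (rule increment_below_profile[OF V W _ N _ that])
      fix x y :: real assume xy: "\<bar>x\<bar> \<le> \<bar>y\<bar>" "\<bar>y\<bar> < 1"
      then have "x \<in> {-1..1}" "y \<in> {-1..1}" by auto
      then have "v y 0 - v x T < \<Phi> (p * y) - \<Phi> (p * x)"
        using init[of x] v0[of x] v0[of y] by simp
      also have "\<dots> \<le> \<Phi> y - \<Phi> x" using contracted_profile_increment(2)[OF p(1) _ xy] p by simp
      finally show "v y 0 - v x (0 + T) \<le> \<Phi> y - \<Phi> x" by simp
    qed (use diag in auto)
  qed
  have B: "v x t \<le> v y (t + T)" if "\<bar>x\<bar> \<le> \<bar>y\<bar>" "\<bar>y\<bar> \<le> 1" "t \<ge> 0" for x y t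
  proof (rule ordered_across_moduli[OF V W _ _ _ that])
    fix x y :: real assume xy: "\<bar>x\<bar> \<le> \<bar>y\<bar>" "\<bar>y\<bar> \<le> 1"
    then have *: "x \<in> {-1..1}" "y \<in> {-1..1}" by auto
    have "\<bar>p * x\<bar> \<le> \<bar>p * y\<bar>" using xy p by (simp add: abs_mult mult_left_mono)
    then have "\<Phi> (p * x) \<le> \<Phi> (p * y)"
      using contracted_profile_increment(1)[of 1 "p * x" "p * y"] small[OF *(2)] by simp
    then have "v x 0 \<le> v y 0" using v0 * by simp
    then show "v x 0 \<le> v y (0 + T)" using init[OF *(2)] by simp
  qed (use diag ends T in auto)
  define s where "s = t - 2 * T"
  have s: "s \<ge> 0" "t = s + 2 * T" using t by (auto simp: s_def)
  have "v y (3 * T + s) \<le> \<Phi> y + v 0 (s + T) + c * (3 * T)"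
  proof -
    obtain N where N: "\<And>x q. x \<in> {-1..1} \<Longrightarrow> 0 < q \<Longrightarrow> q \<le> 3 * T + s \<Longrightarrow> \<bar>vx x q\<bar> \<le> N"
      using slope_bound_persists[OF V lip] by blast
    show ?thesis
    proof (rule below_travelling_wave[OF time_shift_solution[OF V s(1)] _ _ y])
      show "v y (0 + s) \<le> \<Phi> y + v 0 (s + T)" if "\<bar>y\<bar> < 1" for y
        using A[of 0 y s] that s profile by (simp add: travelling_profile_def)
      show "\<bar>vx x (q + s)\<bar> \<le> N" if "x \<in> {-1..1}" "0 < q" "q \<le> 3 * T" for x q
        using N[of x "q + s"] that s by auto
    qed (use T in auto)
  qed
  moreover have "u y t < v y (3 * T + s)" 
  proof -
    have "y \<in> {-1..1}" "t \<ge> 0" using y s T by auto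
    from uv[OF this] show ?thesis using s by (simp add: algebra_simps)
  qed
  moreover have "v 0 (s + T) \<le> v x t" using B[of 0 x "s + T"] x s T by (auto simp: algebra_simps)
  moreover have "v x t < u x t" using vu[OF x] s T by simp
  ultimately show ?thesis by simp
qed

lemma interior_gradient_bounded:
  assumes U: "sol u ux uxx ut" and s: "s > 0" and r: "r < 1" and \<epsilon>: "\<epsilon> > 0"
    and osc: "\<And>x y t. t \<ge> s \<Longrightarrow> \<bar>x\<bar> \<le> r \<Longrightarrow> \<bar>y\<bar> \<le> r \<Longrightarrow> u y t - u x t \<le> C"
  obtains K where "\<And>x t. t \<ge> s \<Longrightarrow> \<bar>x\<bar> \<le> r - \<epsilon> \<Longrightarrow> \<bar>ux x t\<bar> \<le> K"
proof -
  obtain K1 where K1: "\<And>x t. t \<ge> s \<Longrightarrow> \<bar>x\<bar> \<le> r - \<epsilon> \<Longrightarrow> ux x t \<le> K1"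
    by (rule interior_slope_estimate[OF U s \<epsilon> r osc]) auto
  obtain K2 where K2: "\<And>x t. t \<ge> s \<Longrightarrow> \<bar>x\<bar> \<le> r - \<epsilon> \<Longrightarrow> - ux (- x) t \<le> K2"
    by (rule interior_slope_estimate[OF reflected_solution[OF U] s \<epsilon> r, of C]) (use osc in auto)
  have "\<bar>ux x t\<bar> \<le> max K1 K2" if "t \<ge> s" "\<bar>x\<bar> \<le> r - \<epsilon>" for x t
    using K1[OF that] K2[of t "- x"] that by (auto simp: abs_le_iff)
  with that show thesis by blast
qed

end

section \<open>Coefficients given by functions on the circle\<close>

text \<open>The unit normal at slope \<open>p\<close> has angle \<open>\<pi>/2 + arctan p\<close>, so smoothness in the angle becomes
  smoothness in \<open>p\<close>, with derivatives that decay like that of \<open>arctan\<close>.\<close>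

lemma unit_vector_angle:
  "(1 / sqrt (1 + p\<^sup>2)) *\<^sub>R (- p, 1) = (cos (pi / 2 + arctan p), sin (pi / 2 + arctan p))"
  by (simp add: cos_add sin_add sin_arctan cos_arctan)

lemma slope_fun_angle:
  "slope_fun A p = A (cos (pi / 2 + arctan p), sin (pi / 2 + arctan p))"
  unfolding slope_fun_def unit_vector_angle ..

lemma angle_range: "pi / 2 + arctan p \<in> {0..pi}"
  using arctan_bounded[of p] by auto

lemma slope_fun_positive:
  assumes "smooth_on_circle A" "positive_on_circle A"
  obtains a0 where "a0 > 0" "\<And>p. a0 \<le> slope_fun A p"
proof -
  define g where "g = (\<lambda>s. A (cos s, sin s))"
  have "g differentiable (at s)" for s
    using assms(1)[unfolded smooth_on_circle_def, rule_format, of 0 s] by (simp add: g_def)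
  then have "continuous_on {0..pi} g"
    by (intro continuous_at_imp_continuous_on ballI differentiable_imp_continuous_within) auto
  from continuous_attains_inf[OF compact_Icc _ this] obtain z where
    "\<forall>s \<in> {0..pi}. g z \<le> g s" by auto
  then have z: "g z \<le> g s" if "s \<in> {0..pi}" for s using that by blast
  have "g z > 0" using assms(2) by (auto simp: positive_on_circle_def g_def norm_Pair)
  then show thesis using that[of "g z"] z[OF angle_range] by (simp add: slope_fun_angle g_def)
qed

lemma slope_fun_C1:
  assumes "smooth_on_circle A"
  obtains a' G where "G > 0" "\<And>p. (slope_fun A has_real_derivative a' p) (at p)"
    "\<And>p. \<bar>a' p\<bar> \<le> G / (1 + p\<^sup>2)" "\<And>p. \<bar>slope_fun A p\<bar> \<le> G"
proof -
  define g where "g = (\<lambda>s. A (cos s, sin s))"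
  have g: "g differentiable (at s)" "deriv g differentiable (at s)" for s
    using assms(1)[unfolded smooth_on_circle_def, rule_format, of 0 s]
      assms(1)[unfolded smooth_on_circle_def, rule_format, of 1 s] by (simp_all add: g_def)
  have "continuous_on {0..pi} g" "continuous_on {0..pi} (deriv g)"
    using g by (auto intro!: continuous_at_imp_continuous_on differentiable_imp_continuous_within)
  then have "bounded (g ` {0..pi})" "bounded (deriv g ` {0..pi})"
    by (auto intro!: compact_imp_bounded compact_continuous_image)
  then obtain G1 G2 where "\<forall>z \<in> g ` {0..pi}. norm z \<le> G1" "\<forall>z \<in> deriv g ` {0..pi}. norm z \<le> G2"
    unfolding bounded_iff by blast
  then have G12: "\<And>s. s \<in> {0..pi} \<Longrightarrow> \<bar>g s\<bar> \<le> G1" "\<And>s. s \<in> {0..pi} \<Longrightarrow> \<bar>deriv g s\<bar> \<le> G2" by auto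
  define G where "G = max 1 (max G1 G2)"
  have G: "\<bar>g (pi / 2 + arctan p)\<bar> \<le> G" "\<bar>deriv g (pi / 2 + arctan p)\<bar> \<le> G" for p
    using G12[OF angle_range[of p]] by (auto simp: G_def)
  have eq: "slope_fun A = (\<lambda>p. g (pi / 2 + arctan p))" by (simp add: fun_eq_iff slope_fun_angle g_def)
  have dg: "(g has_real_derivative deriv g s) (at s)" for s
    using g(1) by (simp add: DERIV_deriv_iff_real_differentiable)
  have "((\<lambda>p. g (pi / 2 + arctan p)) has_real_derivative
      deriv g (pi / 2 + arctan p) * inverse (1 + p\<^sup>2)) (at p)" for p
  proof -
    have "((\<lambda>p. pi / 2 + arctan p) has_real_derivative 0 + inverse (1 + p\<^sup>2)) (at p)"
      by (rule DERIV_add[OF DERIV_const DERIV_arctan])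
    from DERIV_chain2[OF dg this] show ?thesis by (simp only: add_0)
  qed
  then have d: "(slope_fun A has_real_derivative deriv g (pi / 2 + arctan p) / (1 + p\<^sup>2)) (at p)" for p
    by (simp only: eq divide_inverse)
  have b: "\<bar>deriv g (pi / 2 + arctan p) / (1 + p\<^sup>2)\<bar> \<le> G / (1 + p\<^sup>2)" for p
  proof -
    have "1 + p\<^sup>2 > 0" by (simp add: add_pos_nonneg)
    then show ?thesis using G(2)[of p] by (simp add: divide_right_mono)
  qed
  have "G > 0" by (simp add: G_def)
  moreover have "\<bar>slope_fun A p\<bar> \<le> G" for p using G(1) by (simp add: eq)
  ultimately show thesis by (rule that[OF _ d b])
qed

lemma lipschitz_if_bounded_derivative:
  fixes f :: "real \<Rightarrow> real"
  assumes "\<And>p. (f has_real_derivative f' p) (at p)" "\<And>p. \<bar>f' p\<bar> \<le> B"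
  shows "\<bar>f p - f q\<bar> \<le> B * \<bar>p - q\<bar>"
  using field_differentiable_bound[OF convex_UNIV, of f f' B p q] assms by simp

lemma one_plus_square:
  fixes p :: real
  shows "1 \<le> 1 + p\<^sup>2" "2 * \<bar>p\<bar> \<le> 1 + p\<^sup>2" "\<bar>p\<bar> \<le> sqrt (1 + p\<^sup>2)" "1 \<le> sqrt (1 + p\<^sup>2)"
proof -
  show "1 \<le> 1 + p\<^sup>2" by simp
  show "2 * \<bar>p\<bar> \<le> 1 + p\<^sup>2" using zero_le_power2[of "\<bar>p\<bar> - 1"] by (simp add: power2_diff)
  show "\<bar>p\<bar> \<le> sqrt (1 + p\<^sup>2)" by (rule real_le_rsqrt) simp
  show "1 \<le> sqrt (1 + p\<^sup>2)" by simp
qed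

text \<open>The derivative \<open>a' / (1 + p\<^sup>2) - 2 p a / (1 + p\<^sup>2)\<^sup>2\<close> is bounded since \<open>a\<close> and \<open>a'\<close> are.\<close>

lemma diffusivity_lipschitz_slope_fun:
  assumes "smooth_on_circle A"
  obtains L where "L \<ge> 0" "\<And>p q. \<bar>diffusivity (slope_fun A) p - diffusivity (slope_fun A) q\<bar> \<le> L * \<bar>p - q\<bar>"
proof -
  obtain a' G where G: "G > 0" "\<And>p. (slope_fun A has_real_derivative a' p) (at p)"
    "\<And>p. \<bar>a' p\<bar> \<le> G / (1 + p\<^sup>2)" "\<And>p. \<bar>slope_fun A p\<bar> \<le> G"
    by (rule slope_fun_C1[OF assms]) blast
  define d where "d p = a' p / (1 + p\<^sup>2) - slope_fun A p * (2 * p / (1 + p\<^sup>2)\<^sup>2)" for p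
  have "\<bar>diffusivity (slope_fun A) p - diffusivity (slope_fun A) q\<bar> \<le> (2 * G) * \<bar>p - q\<bar>" for p q
  proof (rule lipschitz_if_bounded_derivative)
    fix p :: real
    have pos: "1 + p\<^sup>2 > 0" "1 + p\<^sup>2 \<noteq> 0" using one_plus_square(1)[of p] by linarith+
    show "(diffusivity (slope_fun A) has_real_derivative d p) (at p)"
      unfolding diffusivity_def d_def using pos
      by (auto intro!: derivative_eq_intros G(2) simp: power2_eq_square divide_simps)
    have "\<bar>a' p\<bar> / (1 + p\<^sup>2) \<le> (G / (1 + p\<^sup>2)) / 1"
      by (rule frac_le) (use G pos one_plus_square(1)[of p] in auto)
    also have "\<dots> \<le> G / 1" unfolding div_by_1 using G one_plus_square(1)[of p] pos
      by (simp add: divide_le_eq mult_le_cancel_left1)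
    finally have 1: "\<bar>a' p / (1 + p\<^sup>2)\<bar> \<le> G" using pos by simp
    have "2 * \<bar>p\<bar> / (1 + p\<^sup>2)\<^sup>2 \<le> 1"
      using one_plus_square[of p] mult_mono[of 1 "1 + p\<^sup>2" "2 * \<bar>p\<bar>" "1 + p\<^sup>2"] pos
      by (simp add: power2_eq_square divide_le_eq)
    then have "\<bar>slope_fun A p\<bar> * (2 * \<bar>p\<bar> / (1 + p\<^sup>2)\<^sup>2) \<le> G * 1"
      using G(1,4) by (intro mult_mono) auto
    then have "\<bar>slope_fun A p * (2 * p / (1 + p\<^sup>2)\<^sup>2)\<bar> \<le> G" by (simp add: abs_mult)
    moreover have "\<bar>d p\<bar> \<le> \<bar>a' p / (1 + p\<^sup>2)\<bar> + \<bar>slope_fun A p * (2 * p / (1 + p\<^sup>2)\<^sup>2)\<bar>"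
      unfolding d_def by (rule abs_triangle_ineq4)
    ultimately show "\<bar>d p\<bar> \<le> 2 * G" using 1 by linarith
  qed
  with that[of "2 * G"] G(1) show thesis by simp
qed

text \<open>The forcing grows linearly in \<open>p\<close>, but its derivative \<open>b' sqrt(1 + p\<^sup>2) + b p / sqrt(1 + p\<^sup>2)\<close> is
  bounded because \<open>b'\<close> decays like \<open>1 / (1 + p\<^sup>2)\<close>.\<close>

lemma forcing_lipschitz_slope_fun:
  assumes "smooth_on_circle B"
  obtains L where "L \<ge> 0" "\<And>p q. \<bar>forcing (slope_fun B) p - forcing (slope_fun B) q\<bar> \<le> L * \<bar>p - q\<bar>"
proof -
  obtain b' G where G: "G > 0" "\<And>p. (slope_fun B has_real_derivative b' p) (at p)"
    "\<And>p. \<bar>b' p\<bar> \<le> G / (1 + p\<^sup>2)" "\<And>p. \<bar>slope_fun B p\<bar> \<le> G"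
    by (rule slope_fun_C1[OF assms]) blast
  define d where "d p = b' p * sqrt (1 + p\<^sup>2) + slope_fun B p * (p / sqrt (1 + p\<^sup>2))" for p
  have "\<bar>forcing (slope_fun B) p - forcing (slope_fun B) q\<bar> \<le> (2 * G) * \<bar>p - q\<bar>" for p q
  proof (rule lipschitz_if_bounded_derivative)
    fix p :: real
    define w where "w = sqrt (1 + p\<^sup>2)"
    have w: "w \<ge> 1" "\<bar>p\<bar> \<le> w" "1 + p\<^sup>2 = w * w" using one_plus_square[of p] by (auto simp: w_def)
    have pos: "1 + p\<^sup>2 > 0" using one_plus_square(1)[of p] by linarith
    show "(forcing (slope_fun B) has_real_derivative d p) (at p)"
      unfolding forcing_def d_def using pos
      by (auto intro!: derivative_eq_intros G(2) simp: divide_simps)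
    have "\<bar>b' p\<bar> * w \<le> G / (w * w) * w" using G(3)[of p] w by (intro mult_right_mono) auto
    also have "\<dots> = G / w" using w by simp
    also have "\<dots> \<le> G" using w G(1) by (simp add: divide_le_eq mult_le_cancel_left1)
    finally have 1: "\<bar>b' p * w\<bar> \<le> G" using w by (simp add: abs_mult)
    have "\<bar>p / w\<bar> \<le> 1" using w by (simp add: divide_le_eq)
    then have "\<bar>slope_fun B p\<bar> * \<bar>p / w\<bar> \<le> G * 1" using G(1,4) by (intro mult_mono) auto
    then have "\<bar>slope_fun B p * (p / w)\<bar> \<le> G" by (simp add: abs_mult)
    moreover have "\<bar>d p\<bar> \<le> \<bar>b' p * w\<bar> + \<bar>slope_fun B p * (p / w)\<bar>"
      unfolding d_def w_def[symmetric] by (rule abs_triangle_ineq)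
    ultimately show "\<bar>d p\<bar> \<le> 2 * G" using 1 by linarith
  qed
  with that[of "2 * G"] G(1) show thesis by simp
qed

section \<open>The interior gradient bound\<close>

text \<open>The two conditions bound the constant from below by explicit numbers, so the minimum is attained at
  the larger of them.\<close>

lemma shift_const_boundary:
  "deriv \<phi> 1 \<le> \<phi> 1 + shift_const \<phi>" "deriv \<phi> (-1) \<ge> - (\<phi> (-1) + shift_const \<phi>)"
proof -
  have "shift_const \<phi> = max (deriv \<phi> 1 - \<phi> 1) (- deriv \<phi> (-1) - \<phi> (-1))"
    unfolding shift_const_def by (rule Least_equality) auto
  then show "deriv \<phi> 1 \<le> \<phi> 1 + shift_const \<phi>" "deriv \<phi> (-1) \<ge> - (\<phi> (-1) + shift_const \<phi>)"
    by auto
qed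

theorem lemma5p2:
  fixes A B :: "real \<times> real \<Rightarrow> real"
    and a b \<phi> \<Phi> \<rho> u0 u0' :: "real \<Rightarrow> real"
    and u v :: "real \<Rightarrow> real \<Rightarrow> real"
    and I :: "real set"
    and cbar T :: real
  assumes "smooth_on_circle A" and "positive_on_circle A"
    and "smooth_on_circle B" and "positive_on_circle (\<lambda>z. - B z)"
    and "a = slope_fun A" and "b = slope_fun B"
    and "\<And>p. a (- p) = a p" and "\<And>p. b (- p) = b p"
    and "(INF p. a p) > - (INF p. b p)"
    and "maximal_profile a b 0 \<phi> I" and "{-1..1} \<subseteq> I"
    and "cbar > 0" and "travelling_profile a b cbar \<Phi>"
    and "admissible_datum \<phi> \<Phi> \<rho>"
    and "\<And>x. x \<in> {-1..1} \<Longrightarrow> (u0 has_real_derivative u0' x) (at x within {-1..1})"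
    and "continuous_on {-1..1} u0'"
    and "u0' 1 = u0 1" and "u0' (-1) = - u0 (-1)"
    and "solves_B a b u0 u" and "solves_B a b \<rho> v"
    and "T > 0"
    and "\<And>x. x \<in> {-1..1} \<Longrightarrow> \<rho> x < u0 x \<and> u0 x < v x T"
  shows "\<forall>\<epsilon>. 0 < \<epsilon> \<and> \<epsilon> < 1/2 \<longrightarrow>
    (\<exists>T\<epsilon> > 0.
       let M2 = (\<Phi> (1 - \<epsilon>) + cbar * T) / \<epsilon>;
           M3 = max M2 (SUP x\<in>{-1..1}. \<bar>Dx u x T\<epsilon>\<bar>)
       in \<forall>x t. -1 + 2 * \<epsilon> < x \<and> x < 1 - 2 * \<epsilon> \<and> t > T\<epsilon> \<longrightarrow> \<bar>Dx u x t\<bar> \<le> M3)"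
proof -
  note A = assms(1,2) and B = assms(3,4) and ab = assms(5,6) and even = assms(7,8)
    and prof = assms(10,11) and front = assms(12,13) and adm = assms(14)
    and sols = assms(19,20) and T = assms(21) and ordered = assms(22)
  obtain a0 where a0: "a0 > 0" "\<And>p. a0 \<le> a p"
    by (rule slope_fun_positive[OF A]) (use ab in auto)
  obtain L1 where L1: "L1 \<ge> 0" "\<And>p q. \<bar>diffusivity a p - diffusivity a q\<bar> \<le> L1 * \<bar>p - q\<bar>"
    by (rule diffusivity_lipschitz_slope_fun[OF A(1)]) (use ab in auto)
  obtain L2 where L2: "L2 \<ge> 0" "\<And>p q. \<bar>forcing b p - forcing b q\<bar> \<le> L2 * \<bar>p - q\<bar>"
    by (rule forcing_lipschitz_slope_fun[OF B(1)]) (use ab in auto)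
  have b_neg: "b p < 0" for p
    using B(2) unfolding ab slope_fun_angle by (auto simp: positive_on_circle_def norm_Pair)
  have lip: "\<bar>diffusivity a p - diffusivity a q\<bar> \<le> (L1 + L2) * \<bar>p - q\<bar>"
    "\<bar>forcing b p - forcing b q\<bar> \<le> (L1 + L2) * \<bar>p - q\<bar>" for p q
    by (rule order_trans[OF L1(2)] order_trans[OF L2(2)], rule mult_right_mono; use L1(1) L2(1) in simp)+
  interpret front_problem a b \<Phi> cbar a0 "L1 + L2"
  proof unfold_locales
    show "a p > 0" for p using a0(1) a0(2)[of p] by linarith
  qed (use even b_neg front a0 L1(1) L2(1) lip in auto)
  obtain ux uxx ut where U: "sol u ux uxx ut" by (rule solves_B_imp_classical_solution[OF sols(1)])
  obtain vx vxx vt where V: "sol v vx vxx vt" by (rule solves_B_imp_classical_solution[OF sols(2)])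
  have u_init: "u x 0 = u0 x" and v_init: "v x 0 = \<rho> x" if "x \<in> {-1..1}" for x
    using sols that by (auto simp: solves_B_def)
  obtain p M1 where p: "0 \<le> p" "p < 1" and M1: "\<And>x. x \<in> {-1..1} \<Longrightarrow> M1 > \<phi> x + shift_const \<phi>"
    and \<rho>: "\<And>x. x \<in> {-1..1} \<Longrightarrow> \<rho> x = \<Phi> (p * x) + M1"
    using adm unfolding admissible_datum_def by blast
  \<comment> \<open>The stationary barrier: it satisfies the boundary condition as an inequality and lies below \<open>\<rho>\<close>.\<close>
  define M where "M = shift_const \<phi>"
  define \<psi> where "\<psi> x = \<phi> x + M" for x
  define \<psi>1 where "\<psi>1 = deriv \<phi>"
  define \<psi>2 where "\<psi>2 = deriv \<psi>1"
  have "\<phi> differentiable (at x)" "\<psi>1 differentiable (at x)"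
    and stat: "flow_rhs a b (\<psi>1 x) (\<psi>2 x) = 0" if "x \<in> {-1..1}" for x
  proof -
    have "x \<in> I" using that prof(2) by blast
    then show "\<phi> differentiable (at x)" "\<psi>1 differentiable (at x)" "flow_rhs a b (\<psi>1 x) (\<psi>2 x) = 0"
      using prof(1) by (auto simp: maximal_profile_def profile_ode_def \<psi>1_def \<psi>2_def)
  qed
  then have d\<psi>: "(\<psi> has_real_derivative \<psi>1 x) (at x)" and d\<psi>1: "(\<psi>1 has_real_derivative \<psi>2 x) (at x)"
    if "x \<in> {-1..1}" for x
    using that unfolding \<psi>_def
    by (auto intro!: derivative_eq_intros simp: \<psi>1_def \<psi>2_def DERIV_deriv_iff_real_differentiable)
  have bc: "\<psi>1 1 \<le> \<psi> 1" "\<psi>1 (-1) \<ge> - \<psi> (-1)"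
    using shift_const_boundary[of \<phi>] by (auto simp: \<psi>1_def \<psi>_def M_def)
  \<comment> \<open>Negative forcing makes the barrier strictly convex, so its outward slopes at \<open>\<plusminus>1\<close>, and with them its boundary values, are positive.\<close>
  have \<psi>2pos: "\<psi>2 x > 0" if "x \<in> {-1..1}" for x
  proof -
    have "diffusivity a (\<psi>1 x) > 0" using a_pos[of "\<psi>1 x"] by (simp add: diffusivity_def add_pos_nonneg)
    moreover have "forcing b (\<psi>1 x) < 0"
      using b_neg[of "\<psi>1 x"] by (simp add: forcing_def mult_neg_pos add_pos_nonneg)
    moreover have "diffusivity a (\<psi>1 x) * \<psi>2 x = - forcing b (\<psi>1 x)"
      using stat[OF that] by (simp add: flow_rhs_eq)
    ultimately show ?thesis by (metis neg_0_less_iff_less zero_less_mult_pos)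
  qed
  have mono: "\<psi>1 x < \<psi>1 y" if "-1 \<le> x" "x < y" "y \<le> 1" for x y
  proof (rule DERIV_pos_imp_increasing[OF that(2)])
    fix z assume "x \<le> z" "z \<le> y"
    then have "z \<in> {-1..1}" using that by auto
    then show "\<exists>l. (\<psi>1 has_real_derivative l) (at z) \<and> 0 < l" using d\<psi>1 \<psi>2pos by blast
  qed
  have "\<psi>1 0 = 0" using prof(1) by (auto simp: maximal_profile_def \<psi>1_def)
  then have end_pos: "\<psi> 1 > 0" "\<psi> (-1) > 0"
    using mono[of 0 1] mono[of "-1" 0] bc by auto
  define R where "R = max \<bar>\<psi>1 1\<bar> \<bar>\<psi>1 (-1)\<bar>"
  have R: "\<bar>\<psi>1 x\<bar> \<le> R" if "x \<in> {-1..1}" for x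
  proof -
    have "\<psi>1 (-1) \<le> \<psi>1 x" "\<psi>1 x \<le> \<psi>1 1"
      using mono[of "-1" x] mono[of x 1] that by (cases "x = -1"; cases "x = 1"; force)+
    then show ?thesis unfolding R_def by linarith
  qed
  note curvature = stationary_curvature_bound[OF stat R]
  have \<rho>_above: "\<psi> x < \<rho> x" if x: "x \<in> {-1..1}" for x
  proof -
    have "\<bar>p * x\<bar> \<le> p" using x p by (auto simp: abs_mult abs_le_iff intro!: mult_left_le)
    then have "\<Phi> (p * x) \<ge> \<Phi> 0"
      using contracted_profile_increment(1)[of 1 0 "p * x"] p by simp
    then show ?thesis
      using M1[OF x] \<rho>[OF x] front(2) by (simp add: \<psi>_def M_def travelling_profile_def)
  qed
  have u0_above: "\<psi> x < u x 0" if "x \<in> {-1..1}" for x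
    using \<rho>_above[OF that] ordered[OF that] u_init[OF that] by simp
  obtain \<delta> where \<delta>: "\<delta> > 0" "\<And>x t. x \<in> {-1..1} \<Longrightarrow> t \<ge> 0 \<Longrightarrow> \<psi> x + \<delta> \<le> u x t"
    by (rule stationary_gap[OF U d\<psi> d\<psi>1 stat bc u0_above]) auto
  obtain d where d: "d > 0" "\<And>x t. x \<in> {-1..1} \<Longrightarrow> t \<ge> 0 \<Longrightarrow> \<psi> x + d \<le> v x t"
    by (rule stationary_gap[OF V d\<psi> d\<psi>1 stat bc]) (use \<rho>_above v_init in auto)
  have v_ends: "v 1 t > 0 \<and> v (-1) t > 0" if "t > 0" for t
    using d(1) d(2)[of 1 t] d(2)[of "-1" t] end_pos that by auto
  have Dx_eq: "Dx u x t = ux x t" if "x \<in> {-1..1}" "t > 0" for x t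
    using vector_derivative_within_cbox[of "-1" 1 x "\<lambda>y. u y t" "ux x t"]
      classical_solutionD(1)[OF U that(2), of x] that(1)
    by (simp add: Dx_def has_real_derivative_iff_has_vector_derivative)
  show ?thesis
  proof (intro allI impI)
    fix \<epsilon> :: real assume \<epsilon>: "0 < \<epsilon> \<and> \<epsilon> < 1/2"
    define s where "s = 2 * T"
    have s: "s > 0" using T by (simp add: s_def)
    have osc: "u y t - u x t \<le> \<Phi> (1 - \<epsilon>) + 3 * cbar * T"
      if "t \<ge> s" "\<bar>x\<bar> \<le> 1 - \<epsilon>" "\<bar>y\<bar> \<le> 1 - \<epsilon>" for x y t
    proof -
      have "u y t - u x t \<le> \<Phi> y + 3 * cbar * T"
      proof (rule oscillation_bound[OF U V T p])
        show "v x 0 = \<Phi> (p * x) + M1" if "x \<in> {-1..1}" for x using v_init \<rho> that by simp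
        show "v x 0 < u x 0" "u x 0 < v x T" if "x \<in> {-1..1}" for x
          using v_init u_init ordered that by simp_all
        show "2 * T \<le> t" using that(1) by (simp add: s_def)
        show "x \<in> {-1..1}" "\<bar>y\<bar> < 1" using that \<epsilon> by auto
      qed (use v_ends in auto)
      moreover have "\<Phi> y \<le> \<Phi> (1 - \<epsilon>)"
        using contracted_profile_increment(1)[of 1 y "1 - \<epsilon>"] that \<epsilon> by simp
      ultimately show ?thesis by simp
    qed
    have r: "1 - \<epsilon> < 1" "\<epsilon> > 0" using \<epsilon> by auto
    obtain K where K: "\<And>x t. t \<ge> s \<Longrightarrow> \<bar>x\<bar> \<le> 1 - \<epsilon> - \<epsilon> \<Longrightarrow> \<bar>ux x t\<bar> \<le> K"
    proof (rule interior_gradient_bounded[OF U s r osc])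
      fix K assume "\<And>x t. t \<ge> s \<Longrightarrow> \<bar>x\<bar> \<le> 1 - \<epsilon> - \<epsilon> \<Longrightarrow> \<bar>ux x t\<bar> \<le> K"
      then show thesis by (rule that)
    qed
    \<comment> \<open>\<open>T\<^sub>\<epsilon>\<close> is a time at which some slope exceeds the interior bound \<open>K\<close>.\<close>
    have "\<exists>t\<ge>s. \<exists>x\<in>{-1..1}. \<bar>ux x t\<bar> > K"
      by (rule unbounded_slopes[OF U d\<psi> d\<psi>1 stat curvature bc \<delta> s])
    then obtain t0 x0 where t0: "t0 \<ge> s" "x0 \<in> {-1..1}" "\<bar>ux x0 t0\<bar> > K" by blast
    then have t0pos: "t0 > 0" using s by simp
    have "continuous_on ({-1..1} \<times> {0<..}) (\<lambda>p. ux (fst p) (snd p))"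
      using U by (simp add: classical_solution_def case_prod_beta)
    from continuous_on_compose2[OF this, of "{-1..1}" "\<lambda>x. (x, t0)"]
    have "continuous_on {-1..1} (\<lambda>x. \<bar>ux x t0\<bar>)" using t0pos by (force intro!: continuous_intros)
    then have "bdd_above ((\<lambda>x. \<bar>ux x t0\<bar>) ` {-1..1})"
      by (intro bounded_imp_bdd_above compact_imp_bounded compact_continuous_image) auto
    then have "\<bar>ux x0 t0\<bar> \<le> (SUP x\<in>{-1..1}. \<bar>ux x t0\<bar>)" by (rule cSUP_upper[OF t0(2)])
    also have "\<dots> = (SUP x\<in>{-1..1}. \<bar>Dx u x t0\<bar>)" using Dx_eq t0pos by (intro SUP_cong) auto
    finally have KN: "K \<le> (SUP x\<in>{-1..1}. \<bar>Dx u x t0\<bar>)" using t0(3) by simp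
    have "\<bar>Dx u x t\<bar> \<le> max M2 (SUP x\<in>{-1..1}. \<bar>Dx u x t0\<bar>)"
      if "-1 + 2 * \<epsilon> < x" "x < 1 - 2 * \<epsilon>" "t > t0" for x t M2
    proof -
      have x: "x \<in> {-1..1}" "\<bar>x\<bar> \<le> 1 - \<epsilon> - \<epsilon>" using that \<epsilon> by auto
      have "\<bar>ux x t\<bar> \<le> K" using K[OF _ x(2)] that t0 by simp
      then show ?thesis using Dx_eq[OF x(1)] that t0pos KN by simp
    qed
    then show "\<exists>T\<epsilon> > 0.
       let M2 = (\<Phi> (1 - \<epsilon>) + cbar * T) / \<epsilon>;
           M3 = max M2 (SUP x\<in>{-1..1}. \<bar>Dx u x T\<epsilon>\<bar>)
       in \<forall>x t. -1 + 2 * \<epsilon> < x \<and> x < 1 - 2 * \<epsilon> \<and> t > T\<epsilon> \<longrightarrow> \<bar>Dx u x t\<bar> \<le> M3"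
      unfolding Let_def using t0pos by (intro exI[of _ t0]) blast
  qed
qed

end
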